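(* Let $K$ be a number field, $\ell$ a prime number, and suppose that $\ell$ is odd or that $\zeta_4\in K$. Let $G$ be a torsion-free subgroup of $K^\times$ of finite rank $r>0$. Let $t\geqslant1$ be the largest integer such that $K_\ell=K_{\ell^t}$. Let $m,n$ be positive integers with $m\geqslant\max(n,t)$. Then $[K_{\ell^m}(\sqrt[\ell^n]{G}):K_{\ell^m}]$ is a power of $\ell$ and $$v_\ell\,[K_{\ell^m}(\sqrt[\ell^n]{G}):K_{\ell^m}]=\max(h_1+n_1,\ldots,h_r+n_r,m)-m+rn-n_1-\cdots-n_r,$$ where $(d_1,\ldots,d_r,h_1,\ldots,h_r)$ expresses the $\ell$-divisibility of $G$ in $K$ and $n_i=\min(n,d_i)$.
   Context: $\zeta_k$ is a primitive $k$-th root of unity, $K_{\ell^n}=K(\zeta_{\ell^n})$, and for $m\geqslant n$, $K_{\ell^m}(\sqrt[\ell^n]{G})$ is the smallest extension of $K_{\ell^m}$ containing an $\ell^n$-th root of every element of $G$. $v_\ell$ is the $\ell$-adic valuation. An element $a\in K^\times$ is strongly $\ell$-indivisible if there is no root of unity $\zeta\in K$ of $\ell$-power order with $a\zeta\in(K^\times)^\ell$. Elements $a_1,\ldots,a_r\in K^\times$ are strongly $\ell$-independent if $a_1^{x_1}\cdots a_r^{x_r}$ is strongly $\ell$-indivisible whenever $x_1,\ldots,x_r$ are integers not all divisible by $\ell$. A tuple $(d_1,\ldots,d_r,h_1,\ldots,h_r)$ of nonnegative integers expresses the $\ell$-divisibility of $G$ in $K$ if $G=\langle B_1^{\ell^{d_1}}\zeta_1,\ldots,B_r^{\ell^{d_r}}\zeta_r\rangle$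 for some strongly $\ell$-independent $B_1,\ldots,B_r\in K^\times$ and some roots of unity $\zeta_i\in K$ of order $\ell^{h_i}$. *)

theory Defs
  imports "HOL-Algebra.Algebra" "HOL-Algebra.Algebraic_Closure_Type"
begin

text \<open>
  All fields are subfields (in the sense of HOL-Algebra) of one algebraically closed field of
  characteristic 0, given as a type. Algebraic_Closure_Type turns such a type into a ring record.
\<close>

abbreviation ambient :: "'a::field ring"
  where "ambient \<equiv> ring_of_type_algebra"

definition number_field :: "'a::field_char_0 set \<Rightarrow> bool"
  where "number_field K \<longleftrightarrow> subfield K ambient \<and> ring.finite_dimension ambient \<rat> K"

definition adjoin :: "'a::field set \<Rightarrow> 'a set \<Rightarrow> 'a set"
  where "adjoin K S = generate_field ambient (K \<union> S)"

text \<open>The value of \<open>field_degree\<close> is meaningful only if \<open>E\<close> is a finite extension of \<open>F\<close>.\<close>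

abbreviation finite_extension :: "'a::field set \<Rightarrow> 'a set \<Rightarrow> bool"
  where "finite_extension F E \<equiv> ring.finite_dimension ambient F E"

abbreviation field_degree :: "'a::field set \<Rightarrow> 'a set \<Rightarrow> nat"
  where "field_degree F E \<equiv> ring.dim ambient F E"

abbreviation mult_group :: "'a::field set \<Rightarrow> 'a monoid"
  where "mult_group K \<equiv> mult_of (ambient\<lparr>carrier := K\<rparr>)"

definition root_of_unity_of_order :: "nat \<Rightarrow> 'a::field \<Rightarrow> bool"
  where "root_of_unity_of_order k z \<longleftrightarrow>
    0 < k \<and> z ^ k = 1 \<and> (\<forall>j. 0 < j \<and> j < k \<longrightarrow> z ^ j \<noteq> 1)"

text \<open>The smallest extension of \<open>E\<close> containing an \<open>N\<close>-th root of every element of \<open>G\<close>.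
  Such a smallest extension exists, and equals the intersection below, when \<open>E\<close> contains the
  \<open>N\<close>-th roots of unity.\<close>

definition radical_extension :: "'a::field set \<Rightarrow> nat \<Rightarrow> 'a set \<Rightarrow> 'a set"
  where "radical_extension E N G =
    \<Inter>{F. subfield F ambient \<and> E \<subseteq> F \<and> (\<forall>g\<in>G. \<exists>x\<in>F. x ^ N = g)}"

definition torsion_free :: "'a::field set \<Rightarrow> bool"
  where "torsion_free G \<longleftrightarrow> (\<forall>g\<in>G. \<forall>k>0. g ^ k = 1 \<longrightarrow> g = 1)"

definition mult_independent :: "'a::field set \<Rightarrow> bool"
  where "mult_independent S \<longleftrightarrow>
    (\<forall>e :: 'a \<Rightarrow> int. (\<Prod>g\<in>S. g powi e g) = 1 \<longrightarrow> (\<forall>g\<in>S. e g = 0))"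

definition has_rank :: "'a::field set \<Rightarrow> nat \<Rightarrow> bool"
  where "has_rank G r \<longleftrightarrow>
    (\<exists>S\<subseteq>G. finite S \<and> mult_independent S \<and> card S = r) \<and>
    (\<forall>S\<subseteq>G. finite S \<and> mult_independent S \<longrightarrow> card S \<le> r)"

definition strongly_indivisible :: "'a::field set \<Rightarrow> nat \<Rightarrow> 'a \<Rightarrow> bool"
  where "strongly_indivisible K l a \<longleftrightarrow>
    a \<in> K - {0} \<and>
    \<not> (\<exists>w\<in>K. (\<exists>k. w ^ (l ^ k) = 1) \<and> (\<exists>b\<in>K - {0}. a * w = b ^ l))"

definition strongly_independent :: "'a::field set \<Rightarrow> nat \<Rightarrow> nat \<Rightarrow> (nat \<Rightarrow> 'a) \<Rightarrow> bool"
  where "strongly_independent K l r a \<longleftrightarrow>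
    (\<forall>i\<in>{1..r}. a i \<in> K - {0}) \<and>
    (\<forall>x :: nat \<Rightarrow> int. \<not> (\<forall>i\<in>{1..r}. int l dvd x i) \<longrightarrow>
       strongly_indivisible K l (\<Prod>i=1..r. a i powi x i))"

definition expresses_divisibility ::
  "'a::field set \<Rightarrow> nat \<Rightarrow> 'a set \<Rightarrow> nat \<Rightarrow> (nat \<Rightarrow> nat) \<Rightarrow> (nat \<Rightarrow> nat) \<Rightarrow> bool"
  where "expresses_divisibility K l G r d h \<longleftrightarrow>
    (\<exists>B w. strongly_independent K l r B \<and>
       (\<forall>i\<in>{1..r}. w i \<in> K \<and> root_of_unity_of_order (l ^ h i) (w i)) \<and>
       G = generate (mult_group K) ((\<lambda>i. B i ^ (l ^ d i) * w i) ` {1..r}))"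

end

theory Submission
  imports Defs
begin

text \<open>
  Over the field \<open>E = K(\<zeta>\<^sub>l)\<close>, which contains a primitive \<open>l^t\<close>-th root of unity \<open>a\<close> but none of order
  \<open>l^(t+1)\<close>, the elements \<open>a, B\<^sub>1, \<dots>, B\<^sub>r\<close> are independent modulo \<open>l\<close>-th powers: since \<open>[E : K]\<close> is prime
  to \<open>l\<close>, a relation over \<open>E\<close> descends to one over \<open>K\<close> by taking norms. Adjoining an \<open>l\<close>-th root
  \<open>\<alpha>\<close> of one element of an independent family multiplies the degree by \<open>l\<close>, and the family in which that
  element is replaced by \<open>\<alpha>\<close> is independent again, so iterated \<open>l\<close>-th roots always give the largest possible
  degree. The asserted extension is such a tower: if \<open>M\<close> is the maximum in the formula, it is obtained from \<open>F\<close>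
  by adjoining a root of unity of order \<open>l^M\<close>, of degree \<open>l^(M-m)\<close>, and then an \<open>l^(n-n\<^sub>i)\<close>-th root
  of each \<open>B\<^sub>i\<close> multiplied by a root of unity. No Galois theory is needed: conjugates of \<open>\<alpha>\<close> are handled by
  evaluating polynomials over \<open>E\<close>.
\<close>

section \<open>Subfields and adjunction\<close>

lemma ambient_simps [simp]:
  "carrier ambient = UNIV" "x \<otimes>\<^bsub>ambient\<^esub> y = x * y" "x \<oplus>\<^bsub>ambient\<^esub> y = x + y"
  "\<one>\<^bsub>ambient\<^esub> = 1" "\<zero>\<^bsub>ambient\<^esub> = 0"
  by (simp_all add: ring_of_type_algebra_def)

interpretation ambient: cring "ambient :: 'a::Fields.field ring"
  by (rule cring_from_type_algebra)

lemma ambient_a_inv [simp]: "\<ominus>\<^bsub>ambient\<^esub> x = - x"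
  by (rule ambient.minus_equality) simp_all

lemma ambient_m_inv: "x \<noteq> 0 \<Longrightarrow> inv\<^bsub>ambient\<^esub> x = inverse x"
  by (rule ambient.inv_char) simp_all

lemma subfield_ambientI:
  fixes E :: "'a::Fields.field set"
  assumes "1 \<in> E" "\<And>x y. x \<in> E \<Longrightarrow> y \<in> E \<Longrightarrow> x + y \<in> E" "\<And>x. x \<in> E \<Longrightarrow> - x \<in> E"
    "\<And>x y. x \<in> E \<Longrightarrow> y \<in> E \<Longrightarrow> x * y \<in> E" "\<And>x. x \<in> E \<Longrightarrow> x \<noteq> 0 \<Longrightarrow> inverse x \<in> E"
  shows "subfield E ambient"
proof (rule field.subfieldI'[OF field_from_type_algebra])
  show "subring E ambient"
    by (rule ambient.subringI) (use assms in auto)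
  fix k assume "k \<in> E - {\<zero>\<^bsub>ambient\<^esub>}"
  then show "inv\<^bsub>ambient\<^esub> k \<in> E"
    using assms(5)[of k] ambient_m_inv[of k] by simp
qed

context
  fixes E :: "'a::Fields.field set"
  assumes E: "subfield E ambient"
begin

lemma subfield_0: "0 \<in> E" and subfield_1: "1 \<in> E"
  using subringE(2,3)[OF subfieldE(1)[OF E]] by simp_all

lemma subfield_add: "x \<in> E \<Longrightarrow> y \<in> E \<Longrightarrow> x + y \<in> E"
  and subfield_mult: "x \<in> E \<Longrightarrow> y \<in> E \<Longrightarrow> x * y \<in> E"
  and subfield_uminus: "x \<in> E \<Longrightarrow> - x \<in> E"
  using subringE(5-7)[OF subfieldE(1)[OF E]] by auto

lemma subfield_diff: "x \<in> E \<Longrightarrow> y \<in> E \<Longrightarrow> x - y \<in> E"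
  using subfield_add[OF _ subfield_uminus, of x y] by simp

lemma subfield_inverse: "x \<in> E \<Longrightarrow> inverse x \<in> E"
  using ambient.subfield_m_inv(1)[OF E, of x] ambient_m_inv[of x] subfield_0
  by (cases "x = 0") auto

lemma subfield_divide: "x \<in> E \<Longrightarrow> y \<in> E \<Longrightarrow> x / y \<in> E"
  by (simp add: divide_inverse subfield_mult subfield_inverse)

lemma subfield_power: "x \<in> E \<Longrightarrow> x ^ k \<in> E"
  by (induction k) (auto intro: subfield_1 subfield_mult)

lemma subfield_sum: "(\<And>i. i \<in> I \<Longrightarrow> f i \<in> E) \<Longrightarrow> (\<Sum>i\<in>I. f i) \<in> E"
  by (induction I rule: infinite_finite_induct) (auto intro: subfield_0 subfield_add)

lemma subfield_prod: "(\<And>i. i \<in> I \<Longrightarrow> f i \<in> E) \<Longrightarrow> (\<Prod>i\<in>I. f i) \<in> E"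
  by (induction I rule: infinite_finite_induct) (auto intro: subfield_1 subfield_mult)

end

lemmas subfield_closed = subfield_0 subfield_1 subfield_add subfield_mult subfield_uminus
  subfield_diff subfield_inverse subfield_divide subfield_power subfield_sum
  subfield_prod

lemma subfield_adjoin: "subfield (adjoin E S) ambient"
  unfolding adjoin_def by (rule field.generate_field_is_subfield[OF field_from_type_algebra]) simp

lemma adjoin_superset: "E \<subseteq> adjoin E S" "S \<subseteq> adjoin E S"
  unfolding adjoin_def by (auto intro: generate_field.incl)

lemma adjoin_least: "subfield M ambient \<Longrightarrow> E \<subseteq> M \<Longrightarrow> S \<subseteq> M \<Longrightarrow> adjoin E S \<subseteq> M"
  unfolding adjoin_def by (rule field.generate_field_min_subfield1[OF field_from_type_algebra]) auto

lemma adjoin_cong: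
  assumes "S \<subseteq> adjoin E T" "T \<subseteq> adjoin E S"
  shows "adjoin E S = adjoin E T"
  using assms by (intro equalityI adjoin_least subfield_adjoin adjoin_superset)

lemma adjoin_absorb:
  assumes "subfield E ambient" "S \<subseteq> E"
  shows "adjoin E S = E"
  using assms adjoin_least[of E E S] adjoin_superset(1)[of E S] by blast

lemma adjoin_adjoin: "adjoin (adjoin E S) T = adjoin E (S \<union> T)"
proof (intro equalityI adjoin_least subfield_adjoin Un_least)
  show "T \<subseteq> adjoin E (S \<union> T)" "S \<subseteq> adjoin E (S \<union> T)"
    using adjoin_superset(2)[of "S \<union> T" E] by auto
  show "E \<subseteq> adjoin E (S \<union> T)" by (rule adjoin_superset)
  show "E \<subseteq> adjoin (adjoin E S) T" "S \<subseteq> adjoin (adjoin E S) T" "T \<subseteq> adjoin (adjoin E S) T"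
    using adjoin_superset(1)[of "adjoin E S" T] adjoin_superset(1)[of E S]
      adjoin_superset(2)[of S E] adjoin_superset(2)[of T "adjoin E S"] by auto
qed

section \<open>Polynomials with coefficients in a subfield\<close>

definition poly_over :: "'a::Fields.field set \<Rightarrow> 'a poly set"
  where "poly_over E = {p. \<forall>i. coeff p i \<in> E}"

context
  fixes E :: "'a::Fields.field set"
  assumes E: "subfield E ambient"
begin

lemma poly_over_0: "0 \<in> poly_over E" and poly_over_1: "1 \<in> poly_over E"
  by (auto simp: poly_over_def coeff_1 subfield_closed[OF E])

lemma poly_over_add: "p \<in> poly_over E \<Longrightarrow> q \<in> poly_over E \<Longrightarrow> p + q \<in> poly_over E"
  and poly_over_diff: "p \<in> poly_over E \<Longrightarrow> q \<in> poly_over E \<Longrightarrow> p - q \<in> poly_over E"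
  and poly_over_uminus: "p \<in> poly_over E \<Longrightarrow> - p \<in> poly_over E"
  and poly_over_smult: "a \<in> E \<Longrightarrow> p \<in> poly_over E \<Longrightarrow> smult a p \<in> poly_over E"
  and poly_over_mult: "p \<in> poly_over E \<Longrightarrow> q \<in> poly_over E \<Longrightarrow> p * q \<in> poly_over E"
  by (auto simp: poly_over_def coeff_mult intro!: subfield_closed[OF E])

lemma poly_over_monom: "a \<in> E \<Longrightarrow> monom a n \<in> poly_over E"
  by (auto simp: poly_over_def subfield_closed[OF E])

lemma poly_over_pCons: "a \<in> E \<Longrightarrow> p \<in> poly_over E \<Longrightarrow> pCons a p \<in> poly_over E"
  by (auto simp: poly_over_def coeff_pCons split: nat.split)

lemma poly_over_power: "p \<in> poly_over E \<Longrightarrow> p ^ n \<in> poly_over E"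
  by (induction n) (auto intro: poly_over_1 poly_over_mult)

lemma poly_over_prod: "(\<And>i. i \<in> I \<Longrightarrow> f i \<in> poly_over E) \<Longrightarrow> (\<Prod>i\<in>I. f i) \<in> poly_over E"
  by (induction I rule: infinite_finite_induct) (auto intro: poly_over_1 poly_over_mult)

lemma poly_over_pcompose: "p \<in> poly_over E \<Longrightarrow> q \<in> poly_over E \<Longrightarrow> pcompose p q \<in> poly_over E"
proof (induction p)
  case (pCons a p)
  then have "a \<in> E" "p \<in> poly_over E"
    by (auto simp: poly_over_def coeff_pCons split: nat.splits)
  with pCons show ?case
    by (auto simp: pcompose_pCons poly_over_0 intro!: poly_over_add poly_over_mult poly_over_pCons)
qed (simp add: poly_over_0)

lemma poly_in_subfield: "p \<in> poly_over E \<Longrightarrow> x \<in> E \<Longrightarrow> poly p x \<in> E"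
  by (auto simp: poly_altdef poly_over_def intro!: subfield_closed[OF E])

text \<open>Long division by induction on the degree: subtracting a monomial multiple of
  \<open>q\<close> cancels the leading term of \<open>p\<close>. The only quotient formed is one of
  leading coefficients, so everything stays over \<open>E\<close>.\<close>

lemma poly_over_division:
  assumes "p \<in> poly_over E" "q \<in> poly_over E" "q \<noteq> 0"
  shows "\<exists>s\<in>poly_over E. \<exists>r\<in>poly_over E. p = s * q + r \<and> (r = 0 \<or> degree r < degree q)"
  using assms(1)
proof (induction "degree p" arbitrary: p rule: less_induct)
  case less
  show ?case
  proof (cases "p = 0 \<or> degree p < degree q")
    case True
    then show ?thesis using less.prems by (intro bexI[of _ 0] bexI[of _ p]) (auto intro: poly_over_0)
  next
    case False
    define c where "c = lead_coeff p / lead_coeff q"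
    define u where "u = monom c (degree p - degree q)"
    have c: "c \<in> E" "c \<noteq> 0" using less.prems assms False
      by (auto simp: c_def poly_over_def intro!: subfield_closed[OF E])
    have u: "u \<in> poly_over E" using c by (auto simp: u_def intro: poly_over_monom)
    have deg: "degree (u * q) = degree p" using c assms False
      by (simp add: u_def degree_mult_eq degree_monom_eq monom_eq_0_iff)
    have lc: "lead_coeff (u * q) = lead_coeff p" using assms False
      by (simp add: lead_coeff_mult u_def c_def degree_monom_eq)
    define p' where "p' = p - u * q"
    have p': "p' \<in> poly_over E" unfolding p'_def using u less.prems assms
      by (intro poly_over_diff poly_over_mult)
    have c0: "coeff p' (degree p) = 0" using lc by (simp add: p'_def deg)
    have "degree p' \<le> degree p" unfolding p'_def by (rule degree_diff_le) (simp_all add: deg)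
    \<comment> \<open>If \<open>p\<close> and \<open>q\<close> are constants, the degree cannot drop
      below 0; then \<open>p' = 0\<close>, hence the separate case.\<close>
    then have "p' = 0 \<or> degree p' < degree p"
      using c0 leading_coeff_0_iff le_neq_implies_less by fastforce
    then have "\<exists>s\<in>poly_over E. \<exists>r\<in>poly_over E. p' = s * q + r \<and> (r = 0 \<or> degree r < degree q)"
    proof
      assume "p' = 0"
      then show ?thesis by (intro bexI[of _ 0]) (auto intro: poly_over_0)
    qed (use less.hyps p' in blast)
    then obtain s r where sr: "s \<in> poly_over E" "r \<in> poly_over E" "p' = s * q + r"
      "r = 0 \<or> degree r < degree q" by blast
    have "p = (s + u) * q + r" using sr(3) by (simp add: p'_def algebra_simps)
    with sr u show ?thesis by (blast intro: poly_over_add)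
  qed
qed

end

section \<open>Minimal polynomials and simple extensions\<close>

definition minpoly :: "'a::Fields.field set \<Rightarrow> 'a \<Rightarrow> 'a poly \<Rightarrow> bool"
  where "minpoly E x q \<longleftrightarrow> q \<in> poly_over E \<and> lead_coeff q = 1 \<and> poly q x = 0 \<and>
    (\<forall>p\<in>poly_over E. p \<noteq> 0 \<longrightarrow> poly p x = 0 \<longrightarrow> degree q \<le> degree p)"

lemma minpoly_nonzero: "minpoly E x q \<Longrightarrow> q \<noteq> 0"
  by (auto simp: minpoly_def)

lemma minpoly_degree_pos: "minpoly E x q \<Longrightarrow> 0 < degree q"
  by (auto simp: minpoly_def intro!: gr0I elim: degree_eq_zeroE)

lemma minpoly_exists:
  assumes E: "subfield E ambient" and p: "p \<in> poly_over E" "p \<noteq> 0" "poly p x = 0"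
  obtains q where "minpoly E x q" "degree q \<le> degree p"
proof -
  define P where "P = (\<lambda>q. q \<in> poly_over E \<and> q \<noteq> 0 \<and> poly q x = 0)"
  obtain q where q: "P q" "\<And>q'. P q' \<Longrightarrow> degree q \<le> degree q'"
    using ex_has_least_nat[of P p degree] p unfolding P_def by blast
  define q' where "q' = smult (inverse (lead_coeff q)) q"
  have nz: "lead_coeff q \<noteq> 0" using q by (auto simp: P_def)
  have "q' \<in> poly_over E" using q unfolding q'_def P_def
    by (intro poly_over_smult[OF E] subfield_inverse[OF E]) (auto simp: poly_over_def)
  moreover have "degree q' = degree q" using nz by (simp add: q'_def)
  ultimately have "minpoly E x q'" "degree q' \<le> degree p"
    using q p nz unfolding minpoly_def P_def by (auto simp: q'_def)
  with that show ?thesis by blast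
qed

lemma minpoly_dvd:
  assumes E: "subfield E ambient" and q: "minpoly E x q" and p: "p \<in> poly_over E" "poly p x = 0"
  shows "q dvd p"
proof -
  obtain s r where sr: "s \<in> poly_over E" "r \<in> poly_over E" "p = s * q + r"
    "r = 0 \<or> degree r < degree q"
    using poly_over_division[OF E p(1) _ minpoly_nonzero[OF q]] q unfolding minpoly_def by blast
  have "poly r x = 0" using p sr q by (simp add: minpoly_def)
  with sr q have "r = 0" unfolding minpoly_def by fastforce
  with sr show ?thesis by simp
qed

lemma poly_low_degree_root_imp_0:
  assumes "minpoly E x q" "p \<in> poly_over E" "poly p x = 0" "degree p < degree q"
  shows "p = 0"
  using assms unfolding minpoly_def by fastforce

text \<open>Euclid's algorithm in the form of an induction: dividing \<open>q\<close> by
  \<open>p\<close> leaves a remainder \<open>r\<close> of smaller degree whose value at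
  \<open>x\<close> is a multiple of that of \<open>p\<close>, so an inverse for \<open>r\<close>
  yields one for \<open>p\<close>. The value of \<open>r\<close> is nonzero, as otherwise
  \<open>q = s * p\<close> and \<open>s\<close> would annihilate \<open>x\<close> in too small a
  degree.\<close>

lemma inverse_poly_over:
  assumes E: "subfield E ambient" and q: "minpoly E x q"
    and p: "p \<in> poly_over E" "poly p x \<noteq> 0" "degree p < degree q"
  shows "\<exists>s\<in>poly_over E. poly p x * poly s x = 1"
  using p
proof (induction "degree p" arbitrary: p rule: less_induct)
  case less
  have q': "q \<in> poly_over E" "poly q x = 0" using q by (auto simp: minpoly_def)
  show ?case
  proof (cases "degree p = 0")
    case True
    then obtain a where a: "p = [:a:]" by (metis degree_0_id)
    with less.prems have "a \<in> E" "a \<noteq> 0" by (auto simp: poly_over_def dest: spec[of _ 0])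
    then show ?thesis
      using a by (intro bexI[of _ "[:inverse a:]"])
        (auto intro!: poly_over_pCons[OF E] poly_over_0[OF E] subfield_inverse[OF E])
  next
    case False
    have "p \<noteq> 0" using less.prems by auto
    then obtain s r where sr: "s \<in> poly_over E" "r \<in> poly_over E" "q = s * p + r"
      "r = 0 \<or> degree r < degree p"
      using poly_over_division[OF E q'(1) less.prems(1)] by blast
    have eq: "poly r x = - (poly s x * poly p x)" using sr(3) q'(2)
      by (metis add_eq_0_iff poly_add poly_mult)
    have snz: "s \<noteq> 0"
      using sr less.prems(3) by auto
    have "poly r x \<noteq> 0"
    proof
      assume 0: "poly r x = 0"
      with sr less.prems q have "r = 0" using poly_low_degree_root_imp_0[OF q sr(2)] by fastforce
      with sr(3) have "q = s * p" by simp
      then have "degree q = degree s + degree p" using snz \<open>p \<noteq> 0\<close> by (simp add: degree_mult_eq)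
      moreover have "poly s x = 0" using 0 eq less.prems by simp
      ultimately show False
        using poly_low_degree_root_imp_0[OF q sr(1)] False snz by simp
    qed
    moreover from this have "degree r < degree p" using sr(4) by auto
    ultimately obtain v where v: "v \<in> poly_over E" "poly r x * poly v x = 1"
      using less.hyps[of r] sr less.prems by auto
    have "poly p x * poly (- (s * v)) x = 1" using v(2) eq by (simp add: algebra_simps)
    moreover have "- (s * v) \<in> poly_over E" using sr v
      by (intro poly_over_uminus[OF E] poly_over_mult[OF E])
    ultimately show ?thesis by blast
  qed
qed

lemma poly_reduce:
  assumes E: "subfield E ambient" and q: "minpoly E x q" and p: "p \<in> poly_over E"
  obtains r where "r \<in> poly_over E" "poly r x = poly p x" "degree r < degree q"
proof -
  obtain s r where sr: "s \<in> poly_over E" "r \<in> poly_over E" "p = s * q + r"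
    "r = 0 \<or> degree r < degree q"
    using poly_over_division[OF E p(1) _ minpoly_nonzero[OF q]] q unfolding minpoly_def by blast
  have "degree r < degree q" using sr minpoly_degree_pos[OF q] by auto
  moreover have "poly r x = poly p x" using q sr(3) by (simp add: minpoly_def)
  ultimately show ?thesis using sr that by blast
qed

text \<open>The values at \<open>x\<close> of polynomials over \<open>E\<close> already form a
  field: a representative is first reduced modulo \<open>q\<close>, and then
  \<open>inverse_poly_over\<close> inverts it.\<close>

lemma adjoin_singleton:
  assumes E: "subfield E ambient" and q: "minpoly E x q"
  shows "adjoin E {x} = {poly p x |p. p \<in> poly_over E \<and> degree p < degree q}"
proof -
  let ?R = "{poly p x |p. p \<in> poly_over E}"
  have "?R = {poly p x |p. p \<in> poly_over E \<and> degree p < degree q}"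
  proof (intro equalityI subsetI)
    fix y assume "y \<in> ?R"
    then obtain p where "p \<in> poly_over E" "y = poly p x" by blast
    moreover obtain r where "r \<in> poly_over E" "poly r x = poly p x" "degree r < degree q"
      by (rule poly_reduce[OF E q \<open>p \<in> poly_over E\<close>])
    ultimately show "y \<in> {poly p x |p. p \<in> poly_over E \<and> degree p < degree q}"
      by (intro CollectI exI[of _ r]) simp
  qed blast
  moreover have "adjoin E {x} = ?R"
  proof (intro equalityI adjoin_least)
    show "subfield ?R ambient"
    proof (rule subfield_ambientI)
      show "1 \<in> ?R" using poly_over_1[OF E] by (auto intro!: exI[of _ 1])
      fix y assume "y \<in> ?R"
      then obtain p where p: "p \<in> poly_over E" "y = poly p x" by blast
      have "- y = poly (- p) x" using p by simp
      then show "- y \<in> ?R" using poly_over_uminus[OF E p(1)] by blast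
      obtain r where r: "r \<in> poly_over E" "poly r x = y" "degree r < degree q"
        by (rule poly_reduce[OF E q p(1)]) (simp add: p(2))
      show "inverse y \<in> ?R" if nz: "y \<noteq> 0"
      proof -
        obtain s where s: "s \<in> poly_over E" "y * poly s x = 1"
          using inverse_poly_over[OF E q r(1) _ r(3)] r(2) nz by auto
        then have "inverse y = poly s x" by (metis inverse_unique)
        with s(1) show ?thesis by blast
      qed
      fix z assume "z \<in> ?R"
      then obtain p' where p': "p' \<in> poly_over E" "z = poly p' x" by blast
      show "y + z \<in> ?R" "y * z \<in> ?R"
        using p p' poly_over_add[OF E p(1) p'(1)] poly_over_mult[OF E p(1) p'(1)]
        by (auto simp flip: poly_add poly_mult)
    qed
    show "E \<subseteq> ?R"
    proof
      fix y assume "y \<in> E"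
      then have "[:y:] \<in> poly_over E" by (intro poly_over_pCons[OF E] poly_over_0[OF E])
      then show "y \<in> ?R" by (intro CollectI exI[of _ "[:y:]"]) simp
    qed
    have "monom 1 1 \<in> poly_over E" by (intro poly_over_monom[OF E] subfield_1[OF E])
    then show "{x} \<subseteq> ?R" by (auto intro!: exI[of _ "monom 1 1"] simp: poly_monom)
    have "poly p x \<in> adjoin E {x}" if "p \<in> poly_over E" for p
      using that adjoin_superset[of E "{x}"] adjoin_superset(2)[of "{x}" E]
      by (intro poly_in_subfield[OF subfield_adjoin]) (auto simp: poly_over_def)
    then show "?R \<subseteq> adjoin E {x}" by blast
  qed
  ultimately show ?thesis by simp
qed

text \<open>The powers of \<open>x\<close> below \<open>degree q\<close> are adjoined one at a time;
  each is a new direction, since a dependence would annihilate \<open>x\<close> in degree below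
  \<open>degree q\<close>. Bounding the support instead of the degree makes \<open>i = 0\<close>
  give the zero space.\<close>

lemma dimension_low_degree:
  assumes E: "subfield E ambient" and q: "minpoly E x q" and "i \<le> degree q"
  shows "ring.dimension ambient i E {poly p x |p. p \<in> poly_over E \<and> (\<forall>k\<ge>i. coeff p k = 0)}"
  using assms(3)
proof (induction i)
  case 0
  have "{poly p x |p. p \<in> poly_over E \<and> (\<forall>k\<ge>0. coeff p k = 0)} = {0}"
  proof -
    have "p = 0" if "\<forall>k\<ge>0. coeff p k = 0" for p :: "'a poly"
      using that by (intro poly_eqI) auto
    then show ?thesis using poly_over_0[OF E] by (intro equalityI subsetI) (force, auto intro!: exI[of _ 0])
  qed
  then show ?case using ambient.zero_dim[of E] by simp
next
  case (Suc i)
  let ?V = "\<lambda>i. {poly p x |p. p \<in> poly_over E \<and> (\<forall>k\<ge>i. coeff p k = 0)}"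
  have notin: "x ^ i \<notin> ?V i"
  proof
    assume "x ^ i \<in> ?V i"
    then obtain p where p: "p \<in> poly_over E" "\<forall>k\<ge>i. coeff p k = 0" "poly p x = x ^ i" by auto
    define u where "u = monom 1 i - p"
    have "u \<in> poly_over E" using p(1) unfolding u_def
      by (intro poly_over_diff[OF E] poly_over_monom[OF E] subfield_1[OF E])
    moreover have "poly u x = 0" by (simp add: u_def p poly_monom)
    moreover have "degree u \<le> i" unfolding u_def using p(2) by (intro degree_le) auto
    ultimately have "u = 0" using Suc.prems poly_low_degree_root_imp_0[OF q] by simp
    moreover have "coeff u i = 1" using p(2) by (simp add: u_def)
    ultimately show False by simp
  qed
  have "?V (Suc i) = ring.line_extension ambient E (x ^ i) (?V i)"
  proof (intro equalityI subsetI)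
    fix y assume "y \<in> ?V (Suc i)"
    then obtain p where p: "p \<in> poly_over E" "\<forall>k\<ge>Suc i. coeff p k = 0" "y = poly p x" by auto
    have c: "coeff p i \<in> E" using p by (simp add: poly_over_def)
    define p' where "p' = p - monom (coeff p i) i"
    have "p' \<in> poly_over E" unfolding p'_def using p c
      by (intro poly_over_diff[OF E] poly_over_monom[OF E])
    moreover have "\<forall>k\<ge>i. coeff p' k = 0" using p(2) by (simp add: p'_def Suc_le_eq)
    moreover have "y = coeff p i * x ^ i + poly p' x" using p by (simp add: p'_def poly_monom)
    ultimately show "y \<in> ring.line_extension ambient E (x ^ i) (?V i)"
      unfolding ambient.line_extension_mem_iff using c by auto
  next
    fix y assume "y \<in> ring.line_extension ambient E (x ^ i) (?V i)"
    then obtain a p where p: "a \<in> E" "p \<in> poly_over E" "\<forall>k\<ge>i. coeff p k = 0"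
      "y = a * x ^ i + poly p x" unfolding ambient.line_extension_mem_iff by auto
    have "monom a i + p \<in> poly_over E" using p by (intro poly_over_add[OF E] poly_over_monom[OF E])
    moreover have "\<forall>k\<ge>Suc i. coeff (monom a i + p) k = 0" using p by auto
    moreover have "y = poly (monom a i + p) x" using p by (simp add: poly_monom)
    ultimately show "y \<in> ?V (Suc i)" by blast
  qed
  then show ?case using ambient.Suc_dim[OF _ notin] Suc by simp
qed

lemma dimension_adjoin_singleton:
  assumes E: "subfield E ambient" and q: "minpoly E x q"
  shows "ring.dimension ambient (degree q) E (adjoin E {x})"
proof -
  have "degree p < degree q \<longleftrightarrow> (\<forall>k\<ge>degree q. coeff p k = 0)" for p :: "'a poly"
    using minpoly_degree_pos[OF q] degree_lessI[of p "degree q"] by (auto intro: coeff_eq_0)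
  then show ?thesis
    using dimension_low_degree[OF E q order.refl] by (simp add: adjoin_singleton[OF E q])
qed

lemma dimension_mono:
  assumes E: "subfield E ambient" and "ring.dimension ambient n E V" "ring.dimension ambient m E W"
    and "V \<subseteq> W"
  shows "n \<le> m"
proof -
  obtain Us where Us: "set Us \<subseteq> carrier ambient" "ring.independent ambient E Us" "length Us = n"
    "ring.Span ambient E Us = V"
    using ambient.exists_base[OF E assms(2)] by blast
  have "set Us \<subseteq> W"
    using ambient.Span_base_incl[OF E Us(1)] Us(4) assms(4) by simp
  then show ?thesis
    using ambient.independent_length_le_dimension[OF E assms(3) Us(2)] Us(3) by simp
qed

text \<open>The two degrees are the dimensions of nested spaces over \<open>E\<close>.\<close>

lemma minpoly_degree_le:
  assumes E: "subfield E ambient" and "minpoly E x p" "minpoly E y q" "y \<in> adjoin E {x}"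
  shows "degree q \<le> degree p"
proof (rule dimension_mono[OF E dimension_adjoin_singleton[OF E] dimension_adjoin_singleton[OF E]])
  show "adjoin E {y} \<subseteq> adjoin E {x}"
    using assms(4) by (intro adjoin_least subfield_adjoin adjoin_superset) simp
qed fact+

section \<open>Roots of unity and radicals of prime degree\<close>

text \<open>A substitute for the norm of \<open>c\<close>: every root of \<open>q\<close> is a root
  of \<open>X^N - c^N\<close>, hence \<open>c\<close> times an \<open>N\<close>-th root of unity.
  The product of all roots is, up to sign, the constant coefficient of \<open>q\<close>, which lies
  in \<open>E\<close>.\<close>

lemma minpoly_radical_norm:
  fixes c :: "'a::alg_closed_field"
  assumes E: "subfield E ambient" and q: "minpoly E c q" and c: "c \<noteq> 0" "c ^ N \<in> E" and "0 < N"
  shows "\<exists>w. w ^ N = 1 \<and> w * c ^ degree q \<in> E"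
proof -
  have "q dvd monom 1 N - [:c ^ N:]"
    using c by (intro minpoly_dvd[OF E q] poly_over_diff[OF E] poly_over_monom[OF E]
        poly_over_pCons[OF E] poly_over_0[OF E] subfield_1[OF E]) (auto simp: poly_monom)
  then have root: "x ^ N = c ^ N" if "poly q x = 0" for x
    using that by (auto simp: poly_monom elim!: dvdE dest!: arg_cong[of _ _ "\<lambda>p. poly p x"])
  obtain R where R: "size R = degree q" "q = (\<Prod>x\<in>#R. [:- x, 1:])"
    using alg_closed_imp_factorization[OF minpoly_nonzero[OF q]] q by (auto simp: minpoly_def)
  have "x ^ N = c ^ N" if "x \<in># R" for x
    using that by (intro root) (auto simp: R(2) poly_prod_mset prod_mset_zero_iff image_iff)
  then have "(\<Prod>x\<in>#R. x / c) ^ N = 1"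
    using c by (induction R) (auto simp: power_mult_distrib power_divide)
  moreover have "(\<Prod>x\<in>#R. x / c) * c ^ size R = (\<Prod>x\<in>#R. x)"
    using c by (induction R) (auto simp: field_simps)
  moreover have "poly (\<Prod>x\<in>#R. [:- x, 1:]) 0 = (- 1) ^ size R * (\<Prod>x\<in>#R. x)"
    by (induction R) auto
  then have "(\<Prod>x\<in>#R. x) = (- 1) ^ size R * poly q 0"
    by (simp flip: R(2) power_mult_distrib mult.assoc)
  moreover have "poly q 0 \<in> E" using q
    by (intro poly_in_subfield[OF E] subfield_0[OF E]) (simp add: minpoly_def)
  ultimately show ?thesis
    unfolding R(1)[symmetric]
    by (intro exI[of _ "\<Prod>x\<in>#R. x / c"])
      (simp add: subfield_mult[OF E] subfield_power[OF E] subfield_uminus[OF E] subfield_1[OF E])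
qed

section \<open>Orders and powers of roots of unity\<close>

lemma root_of_unity_nonzero: "root_of_unity_of_order k z \<Longrightarrow> z \<noteq> 0"
  by (auto simp: root_of_unity_of_order_def power_0_left)

lemma root_of_unity_power_eq_1_iff:
  assumes "root_of_unity_of_order k z"
  shows "z ^ j = 1 \<longleftrightarrow> k dvd j"
proof -
  have "z ^ j = z ^ (j mod k)"
  proof -
    have "z ^ j = (z ^ k) ^ (j div k) * z ^ (j mod k)"
      by (simp flip: power_mult power_add)
    then show ?thesis using assms by (simp add: root_of_unity_of_order_def)
  qed
  then show ?thesis
    using assms by (auto simp: root_of_unity_of_order_def mod_eq_0_iff_dvd[symmetric])
qed

lemma root_of_unity_power_inj:
  assumes z: "root_of_unity_of_order k z" and "z ^ i = z ^ j" "i < k" "j < k"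
  shows "i = j"
  using assms
proof (induction i j rule: linorder_wlog)
  case (le i j)
  have "z ^ j = z ^ i * z ^ (j - i)" using le(1) by (simp flip: power_add)
  then have "z ^ (j - i) = 1" using le root_of_unity_nonzero[OF z] by simp
  then show ?case using le by (auto simp: root_of_unity_power_eq_1_iff[OF z] dest: dvd_imp_le)
qed simp

text \<open>\<open>X^k - 1\<close> has at most \<open>k\<close> roots, and the powers of
  \<open>z\<close> already supply \<open>k\<close> distinct ones.\<close>

lemma root_of_unity_exponent:
  fixes z :: "'a::Fields.field"
  assumes z: "root_of_unity_of_order k z" and "w ^ k = 1"
  obtains j where "j < k" "w = z ^ j"
proof -
  have k: "0 < k" using z by (simp add: root_of_unity_of_order_def)
  define p where "p = monom (1::'a) k - 1"
  have "p \<noteq> 0" using k by (auto simp: p_def dest!: arg_cong[of _ _ "\<lambda>p. coeff p k"])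
  have roots: "{x. poly p x = 0} = {x. x ^ k = 1}" by (auto simp: p_def poly_monom)
  have "degree p \<le> k" unfolding p_def by (intro degree_diff_le) (auto simp: degree_monom_le)
  then have "card {x. poly p x = 0} \<le> k" using card_poly_roots_bound[OF \<open>p \<noteq> 0\<close>] by linarith
  moreover have "finite {x. poly p x = 0}" using poly_roots_finite[OF \<open>p \<noteq> 0\<close>] .
  moreover have "(\<lambda>j. z ^ j) ` {..<k} \<subseteq> {x. poly p x = 0}"
    unfolding roots using z by (auto simp: root_of_unity_of_order_def power_mult[symmetric] mult.commute)
      (metis mult.commute power_mult power_one)
  moreover have "card ((\<lambda>j. z ^ j) ` {..<k}) = k"
    by (subst card_image) (auto intro!: inj_onI root_of_unity_power_inj[OF z])
  ultimately have "(\<lambda>j. z ^ j) ` {..<k} = {x. x ^ k = 1}"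
    by (metis roots card_seteq)
  then show ?thesis using assms(2) that by blast
qed

text \<open>The order divides \<open>l ^ Suc a\<close> but not \<open>l ^ a\<close>, and the
  divisors of a prime power form a chain.\<close>

lemma root_of_unity_prime_power:
  assumes l: "Factorial_Ring.prime (l::nat)" and "x ^ (l ^ Suc a) = 1" "x ^ (l ^ a) \<noteq> 1"
  shows "root_of_unity_of_order (l ^ Suc a) x"
proof -
  define k where "k = (LEAST k. 0 < k \<and> x ^ k = 1)"
  have ex: "\<exists>k. 0 < k \<and> x ^ k = 1" using assms prime_gt_0_nat[OF l] by (intro exI[of _ "l ^ Suc a"]) auto
  have k: "root_of_unity_of_order k x"
    unfolding root_of_unity_of_order_def k_def using LeastI_ex[OF ex] not_less_Least
    by (metis (mono_tags, lifting))
  obtain b where b: "b \<le> Suc a" "k = l ^ b"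
    using assms(2) divides_primepow_nat[OF l, of k "Suc a"] root_of_unity_power_eq_1_iff[OF k, of "l ^ Suc a"] by blast
  have "\<not> b \<le> a" using assms(3) b by (auto simp: root_of_unity_power_eq_1_iff[OF k] le_imp_power_dvd)
  with b have "k = l ^ Suc a" by (simp add: le_Suc_eq)
  with k show ?thesis by simp
qed

section \<open>Extensions by a root of prime degree\<close>

lemma radical_polynomial:
  fixes A :: "'a::Fields.field"
  assumes "0 < l"
  shows "degree (monom 1 l - [:A:]) = l" "lead_coeff (monom 1 l - [:A:]) = 1"
    "subfield E ambient \<Longrightarrow> A \<in> E \<Longrightarrow> monom 1 l - [:A:] \<in> poly_over E"
proof -
  have c: "coeff (monom 1 l - [:A:]) l = 1" 
  proof -
    obtain k where "l = Suc k" using assms gr0_conv_Suc by blast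
    then show ?thesis by simp
  qed
  have "degree (monom 1 l - [:A:]) \<le> l"
    by (intro degree_diff_le) (auto simp: degree_monom_le)
  moreover have "l \<le> degree (monom 1 l - [:A:])" by (rule le_degree, subst c, simp)
  ultimately show deg: "degree (monom 1 l - [:A:]) = l" by simp
  show "lead_coeff (monom 1 l - [:A:]) = 1" unfolding deg by (rule c)
  assume E: "subfield E ambient" "A \<in> E"
  then show "monom 1 l - [:A:] \<in> poly_over E"
    by (intro poly_over_diff[OF E(1)] poly_over_monom[OF E(1)]
        poly_over_pCons[OF E(1)] poly_over_0[OF E(1)] subfield_1[OF E(1)])
qed

text \<open>Were the degree \<open>D\<close> of \<alpha> below \<open>l\<close>,
  \<open>minpoly_radical_norm\<close> would put \<alpha> to the power \<open>D\<close> into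
  \<open>E\<close>, up to a root of unity that \<open>E\<close> contains. As \<open>D\<close> is
  prime to \<open>l\<close>, \<alpha> itself would lie in \<open>E\<close>, making \<open>A\<close>
  an \<open>l\<close>-th power there.\<close>

lemma minpoly_radical:
  fixes \<alpha> :: "'a::alg_closed_field"
  assumes l: "Factorial_Ring.prime (l::nat)" and E: "subfield E ambient"
    and z: "z \<in> E" "root_of_unity_of_order l z"
    and A: "\<alpha> ^ l = A" "A \<in> E" "\<And>c. c \<in> E \<Longrightarrow> c ^ l \<noteq> A"
  shows "minpoly E \<alpha> (monom 1 l - [:A:])"
proof -
  have l0: "0 < l" using prime_gt_0_nat[OF l] .
  have nz: "\<alpha> \<noteq> 0" using A(1) A(3)[OF subfield_0[OF E]] l0 by (auto simp: power_0_left)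
  have "l \<le> degree p" if p: "p \<in> poly_over E" "p \<noteq> 0" "poly p \<alpha> = 0" for p
  proof (rule ccontr)
    assume "\<not> l \<le> degree p"
    then obtain q where q: "minpoly E \<alpha> q" "degree q < l"
      using minpoly_exists[OF E p] by (metis not_le order.strict_trans1)
    define D where "D = degree q"
    obtain w where w: "w ^ l = 1" "w * \<alpha> ^ D \<in> E"
      using minpoly_radical_norm[OF E q(1) nz, of l] A l0 unfolding D_def by blast
    have "w \<in> E" using root_of_unity_exponent[OF z(2) w(1)] subfield_power[OF E z(1)] by metis
    moreover have "w \<noteq> 0" using w l0 by (auto simp: power_0_left)
    ultimately have "\<alpha> ^ D \<in> E" using subfield_divide[OF E w(2), of w] by simp
    have "\<not> l dvd D" using minpoly_degree_pos[OF q(1)] q(2) by (auto simp: D_def dest: dvd_imp_le)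
    then have "gcd D l = 1" using l by (metis coprime_commute coprime_iff_gcd_eq_1 prime_imp_coprime)
    then obtain a b where ab: "D * a = l * b + 1"
      using bezout_nat[of D l] minpoly_degree_pos[OF q(1)] by (auto simp: D_def)
    have "(\<alpha> ^ D) ^ a = A ^ b * \<alpha>" using ab A(1) by (simp flip: power_mult) (simp add: power_add power_mult)
    then have "\<alpha> = (\<alpha> ^ D) ^ a / A ^ b" using nz A(1)[symmetric] by (simp add: field_simps)
    moreover have "(\<alpha> ^ D) ^ a / A ^ b \<in> E"
      by (intro subfield_divide[OF E] subfield_power[OF E] \<open>\<alpha> ^ D \<in> E\<close> A)
    ultimately show False using A(1,3) by metis
  qed
  then show ?thesis unfolding minpoly_def
    using radical_polynomial(3)[OF l0 E A(2)] A(1)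
    by (simp add: radical_polynomial(1)[OF l0] radical_polynomial(2)[OF l0, unfolded radical_polynomial(1)[OF l0]]
        poly_monom del: coeff_diff)
qed

lemma coeff_pcompose_scale: "coeff (pcompose p [:0, z:]) k = z ^ k * coeff p k"
  for z :: "'a::comm_ring_1"
proof (induction p arbitrary: k)
  case (pCons a p)
  then show ?case
    by (cases k) (auto simp: pcompose_pCons coeff_pCons algebra_simps)
qed simp

text \<open>The product \<open>P\<close> of the polynomials \<open>p(z^i X)\<close> is unchanged
  under \<open>X \<mapsto> z X\<close>, which permutes its factors cyclically. Hence only exponents
  divisible by \<open>l\<close> occur in \<open>P\<close>, and those powers of \<alpha> lie in
  \<open>E\<close>.\<close>

lemma norm_in_subfield:
  assumes E: "subfield E ambient" and z: "z \<in> E" "root_of_unity_of_order l z"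
    and \<alpha>: "\<alpha> ^ l \<in> E" and p: "p \<in> poly_over E"
  shows "(\<Prod>i<l. poly p (z ^ i * \<alpha>)) \<in> E"
proof -
  define P where "P = (\<Prod>i<l. pcompose p [:0, z ^ i:])"
  have zl: "z ^ l = 1" "0 < l" using z by (auto simp: root_of_unity_of_order_def)
  have P: "P \<in> poly_over E" unfolding P_def
    by (intro poly_over_prod[OF E] poly_over_pcompose[OF E] p poly_over_pCons[OF E]
        subfield_power[OF E] z poly_over_0[OF E] subfield_0[OF E])
  have "pcompose P [:0, z:] = (\<Prod>i<l. pcompose p [:0, z ^ Suc i:])"
    unfolding P_def pcompose_prod
    by (intro prod.cong refl) (simp add: pcompose_pCons mult.commute flip: pcompose_assoc)
  also have "\<dots> = (\<Prod>i\<in>Suc ` {..<l}. pcompose p [:0, z ^ i:])"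
    by (subst prod.reindex) auto
  also have "\<dots> = P"
  proof -
    obtain l' where l': "l = Suc l'" using zl by (cases l) auto
    have "(\<Prod>i\<in>Suc ` {..<l}. pcompose p [:0, z ^ i:])
        = (\<Prod>i<l'. pcompose p [:0, z ^ Suc i:]) * pcompose p [:0, z ^ l:]"
      by (subst prod.reindex) (auto simp: l')
    also have "\<dots> = P"
      unfolding P_def by (subst (2) l', subst prod.lessThan_Suc_shift) (simp add: zl mult.commute)
    finally show ?thesis .
  qed
  finally have inv: "pcompose P [:0, z:] = P" .
  have "coeff P k * \<alpha> ^ k \<in> E" for k
  proof (cases "l dvd k")
    case True
    then obtain m where "k = l * m" by blast
    with \<alpha> P show ?thesis
      by (auto simp: power_mult poly_over_def intro!: subfield_closed[OF E])
  next
    case False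
    have "z ^ k * coeff P k = coeff P k" using coeff_pcompose_scale[of P z k] inv by simp
    then have "coeff P k = 0" using False root_of_unity_power_eq_1_iff[OF z(2), of k] by auto
    then show ?thesis by (simp add: subfield_0[OF E])
  qed
  then have "poly P \<alpha> \<in> E" unfolding poly_altdef by (intro subfield_sum[OF E])
  then show ?thesis by (simp add: P_def poly_prod poly_pcompose mult.commute)
qed

text \<open>This replaces the automorphism sending \<alpha> to \<beta>: algebraic relations over
  \<open>E\<close> pass from one root of the minimal polynomial to another.\<close>

lemma radical_conjugate_root:
  assumes E: "subfield E ambient" and q: "minpoly E \<alpha> (monom 1 l - [:A:])"
    and "p \<in> poly_over E" "poly p \<alpha> = 0" "\<beta> ^ l = A"
  shows "poly p \<beta> = 0"
proof -
  have "(monom 1 l - [:A:]) dvd p" using minpoly_dvd[OF E q] assms by blast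
  then show ?thesis using assms(5) by (auto simp: poly_monom elim!: dvdE)
qed

text \<open>Kummer theory in a radical extension of prime degree: an element with \<open>l\<close>-th power in the base
  field is multiplied by a power of \<open>z\<close> under the conjugation \<open>\<alpha> \<mapsto> z * \<alpha>\<close>.\<close>

lemma kummer_monomial:
  assumes E: "subfield E ambient" and z: "z \<in> E" "root_of_unity_of_order l z"
    and q: "minpoly E \<alpha> (monom 1 l - [:A:])"
    and c: "c \<in> adjoin E {\<alpha>}" "c ^ l \<in> E" "c \<noteq> 0"
  shows "\<exists>j. \<exists>e\<in>E. c = e * \<alpha> ^ j"
proof -
  have zl: "z ^ l = 1" "0 < l" using z by (auto simp: root_of_unity_of_order_def)
  have \<alpha>: "\<alpha> ^ l = A" using q by (simp add: minpoly_def poly_monom)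
  note deg = radical_polynomial(1)[OF zl(2), of A]
  obtain p where p: "p \<in> poly_over E" "degree p < l" "c = poly p \<alpha>"
    using c(1) unfolding adjoin_singleton[OF E q] deg by blast
  have "poly (p ^ l - [:c ^ l:]) (z * \<alpha>) = 0"
    by (rule radical_conjugate_root[OF E q])
      (use p c zl \<alpha> in \<open>auto simp: power_mult_distrib intro!: poly_over_diff[OF E] poly_over_power[OF E]
        poly_over_pCons[OF E] poly_over_0[OF E]\<close>)
  then have "(poly p (z * \<alpha>) / c) ^ l = 1" using c by (simp add: power_divide)
  then obtain j where j: "j < l" "poly p (z * \<alpha>) / c = z ^ j"
    using root_of_unity_exponent[OF z(2)] by metis
  \<comment> \<open>\<open>p'\<close> vanishes at \<alpha> and has degree below \<open>l\<close>, so
    it is zero. Its coefficients are those of \<open>p\<close> times \<open>z ^ k - z ^ j\<close>,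
    so \<open>p\<close> is a monomial of exponent \<open>j\<close>.\<close>
  define p' where "p' = pcompose p [:0, z:] - smult (z ^ j) p"
  have "p' \<in> poly_over E" unfolding p'_def
    by (intro poly_over_diff[OF E] poly_over_pcompose[OF E] p poly_over_smult[OF E]
        poly_over_pCons[OF E] poly_over_0[OF E] subfield_power[OF E] z subfield_0[OF E])
  moreover have "poly p' \<alpha> = 0" using j(2) c p
    by (simp add: p'_def poly_pcompose mult.commute field_simps)
  moreover have "degree p' < l" unfolding p'_def
    by (intro degree_diff_less) (use p(2) degree_pcompose_le[of p "[:0, z:]"] degree_smult_le[of "z ^ j" p] in
      \<open>auto intro: le_less_trans\<close>)
  ultimately have "p' = 0" using poly_low_degree_root_imp_0[OF q] deg by simp
  have "coeff p k = 0" if "k \<noteq> j" for k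
  proof (cases "k < l")
    case True
    have "coeff p' k = (z ^ k - z ^ j) * coeff p k"
      by (simp add: p'_def coeff_pcompose_scale algebra_simps)
    moreover have "z ^ k \<noteq> z ^ j" using root_of_unity_power_inj[OF z(2)] that True j by blast
    ultimately show ?thesis using \<open>p' = 0\<close> by simp
  qed (use p(2) in \<open>auto intro: coeff_eq_0\<close>)
  then have "p = monom (coeff p j) j" by (intro poly_eqI) auto
  then have "c = coeff p j * \<alpha> ^ j" using p(3) by (metis poly_monom)
  moreover have "coeff p j \<in> E" using p(1) by (simp add: poly_over_def)
  ultimately show ?thesis by blast
qed

section \<open>Independence modulo powers\<close>

text \<open>For prime \<open>l\<close>: linear independence, over the field with \<open>l\<close>
  elements, of the classes of the \<open>A i\<close> in the multiplicative group of \<open>E\<close>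
  modulo \<open>l\<close>-th powers. Natural exponents suffice because exponents count only modulo
  \<open>l\<close>.\<close>

definition power_independent :: "'a::Fields.field set \<Rightarrow> nat \<Rightarrow> 'i set \<Rightarrow> ('i \<Rightarrow> 'a) \<Rightarrow> bool"
  where "power_independent E l I A \<longleftrightarrow> (\<forall>i\<in>I. A i \<in> E - {0}) \<and>
    (\<forall>x :: 'i \<Rightarrow> nat. (\<exists>c\<in>E. c ^ l = (\<Prod>i\<in>I. A i ^ x i)) \<longrightarrow> (\<forall>i\<in>I. l dvd x i))"

lemma power_independentD:
  assumes "power_independent E l I A" "c \<in> E" "c ^ l = (\<Prod>i\<in>I. A i ^ x i)" "i \<in> I"
  shows "l dvd x i"
  using assms unfolding power_independent_def by blast

lemma power_independent_not_power:
  assumes A: "power_independent E l I A" and "finite I" "i \<in> I" "1 < l" "c \<in> E"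
  shows "c ^ l \<noteq> A i"
proof
  assume "c ^ l = A i"
  also have "A i = (\<Prod>k\<in>I. A k ^ of_bool (k = i))"
    using assms by (subst prod.remove[of _ i]) auto
  finally have "l dvd of_bool (i = i)"
    by (rule power_independentD[OF A \<open>c \<in> E\<close>]) fact
  with assms show False by simp
qed

lemma power_independent_cong:
  assumes "\<And>i. i \<in> I \<Longrightarrow> A i = B i"
  shows "power_independent E l I A = power_independent E l I B"
  using assms unfolding power_independent_def by simp

text \<open>This power of \<open>z\<close> is the factor by which the product of all conjugates of
  \<alpha> differs from \<open>\<alpha> ^ l\<close>. It is 1 for odd \<open>l\<close>; for
  \<open>l = 2\<close> it is -1, and here a square root of -1 in \<open>E\<close> is
  required.\<close>

lemma triangular_root_of_unity:
  fixes z :: "'a::Fields.field"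
  assumes l: "Factorial_Ring.prime l" and z: "root_of_unity_of_order l z"
    and E: "subfield E ambient" and i: "odd l \<or> (\<exists>u\<in>E. u ^ 2 = - 1)"
  obtains u where "u \<in> E" "u ^ l = z ^ (\<Sum>i<l. i)" "u \<noteq> 0"
proof (cases "odd l")
  case True
  then obtain k where k: "l = 2 * k + 1" by (elim oddE)
  have "(\<Sum>i<l. i) = l * k"
    using Sum_Ico_nat[of 0 l] by (simp add: k atLeast0LessThan[symmetric])
  then have "1 ^ l = z ^ (\<Sum>i<l. i)" by (simp add: root_of_unity_power_eq_1_iff[OF z])
  with that[of 1] show ?thesis using subfield_1[OF E] by simp
next
  case False
  with l have l2: "l = 2" by (metis prime_odd_nat nat_less_le prime_ge_2_nat)
  from False i obtain u where u: "u \<in> E" "u ^ 2 = - 1" by blast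
  have "z ^ 2 = 1" "z \<noteq> 1"
    using z unfolding l2 root_of_unity_of_order_def by (auto dest: spec[of _ 1])
  then have "z = - 1" by (simp add: power2_eq_1_iff)
  moreover have "u \<noteq> 0" using u(2) by auto
  ultimately show ?thesis using u that[of u] by (simp add: l2 numeral_2_eq_2)
qed

text \<open>Given a relation over the larger field, a norm down to \<open>E\<close> shows that
  \<open>l\<close> divides the exponent of \<alpha>. After division by a power of \<alpha>,
  \<open>kummer_monomial\<close> turns the rest into a relation over \<open>E\<close> between the
  original elements.\<close>

lemma power_independent_adjoin_root:
  fixes \<alpha> :: "'a::alg_closed_field"
  assumes l: "Factorial_Ring.prime l" and E: "subfield E ambient"
    and z: "z \<in> E" "root_of_unity_of_order l z" and sq: "odd l \<or> (\<exists>u\<in>E. u ^ 2 = - 1)"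
    and I: "finite I" "j \<in> I" and A: "power_independent E l I A" and \<alpha>: "\<alpha> ^ l = A j"
  shows "minpoly E \<alpha> (monom 1 l - [:A j:])"
    and "power_independent (adjoin E {\<alpha>}) l I (A(j := \<alpha>))"
proof -
  have l0: "0 < l" "1 < l" using prime_gt_1_nat[OF l] by auto
  have AE: "A i \<in> E" "A i \<noteq> 0" if "i \<in> I" for i
    using A that by (auto simp: power_independent_def)
  show q: "minpoly E \<alpha> (monom 1 l - [:A j:])"
    using AE I power_independent_not_power[OF A I l0(2)] by (intro minpoly_radical[OF l E z \<alpha>]) auto
  have \<alpha>nz: "\<alpha> \<noteq> 0" using \<alpha> AE[OF I(2)] l0 by (auto simp: power_0_left)
  note E' = subfield_adjoin[of E "{\<alpha>}"]
  have \<alpha>E': "\<alpha> \<in> adjoin E {\<alpha>}" using adjoin_superset(2)[of "{\<alpha>}" E] by simp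
  have "\<forall>i\<in>I. l dvd x i"
    if c: "c \<in> adjoin E {\<alpha>}" "c ^ l = (\<Prod>i\<in>I. (A(j := \<alpha>)) i ^ x i)" for x c
  proof -
    define y where "y = (\<Prod>i\<in>I - {j}. A i ^ x i)"
    have y: "y \<in> E" "y \<noteq> 0" unfolding y_def using AE I
      by (auto intro!: subfield_prod[OF E] subfield_power[OF E])
    have prod: "(\<Prod>i\<in>I. (A(j := a)) i ^ x i) = a ^ x j * y" for a
      using I unfolding y_def by (subst prod.remove[of _ j]) (auto intro!: prod.cong)
    have cy: "c ^ l = y * \<alpha> ^ x j" using c(2) unfolding prod by simp
    obtain p where p: "p \<in> poly_over E" "c = poly p \<alpha>"
      using c(1) unfolding adjoin_singleton[OF E q] by blast
    have conj: "poly p (z ^ i * \<alpha>) ^ l = y * (z ^ i * \<alpha>) ^ x j" for i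
    proof -
      have "poly (p ^ l - monom y (x j)) (z ^ i * \<alpha>) = 0"
      proof (rule radical_conjugate_root[OF E q])
        show "p ^ l - monom y (x j) \<in> poly_over E"
          using p y by (intro poly_over_diff[OF E] poly_over_power[OF E] poly_over_monom[OF E])
        show "poly (p ^ l - monom y (x j)) \<alpha> = 0" using cy p by (simp add: poly_monom)
        have "(z ^ i) ^ l = (z ^ l) ^ i" by (simp add: mult.commute flip: power_mult)
        then show "(z ^ i * \<alpha>) ^ l = A j"
          using \<alpha> z by (simp add: power_mult_distrib root_of_unity_of_order_def)
      qed
      then show ?thesis by (simp add: poly_monom)
    qed
    define N where "N = (\<Prod>i<l. poly p (z ^ i * \<alpha>))"
    have N: "N \<in> E" unfolding N_def
      using AE I by (intro norm_in_subfield[OF E z _ p(1)]) (simp add: \<alpha>)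
    obtain u where u: "u \<in> E" "u ^ l = z ^ (\<Sum>i<l. i)" "u \<noteq> 0"
      using triangular_root_of_unity[OF l z(2) E sq] .
    \<comment> \<open>The conjugates of \<alpha> multiply to \<open>u ^ l * A j\<close>, so up to
      \<open>l\<close>-th powers only \<open>A j ^ x j\<close> remains.\<close>
    have "N ^ l = (\<Prod>i<l. y * (z ^ i * \<alpha>) ^ x j)"
      unfolding N_def by (simp add: conj prod_power_distrib)
    also have "\<dots> = y ^ l * ((\<Prod>i<l. z ^ i) * \<alpha> ^ l) ^ x j"
      by (simp add: prod.distrib flip: prod_power_distrib)
    also have "\<dots> = y ^ l * (u ^ l * A j) ^ x j"
      by (simp add: u(2) \<alpha> power_sum)
    finally have "N ^ l = (y * u ^ x j) ^ l * A j ^ x j"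
      by (simp add: power_mult_distrib flip: power_mult) (simp add: mult.commute)
    then have "(N / (y * u ^ x j)) ^ l = A j ^ x j"
      using y u by (simp add: power_divide)
    also have "A j ^ x j = (\<Prod>i\<in>I. A i ^ (if i = j then x j else 0))"
      using I by (subst prod.remove[of _ j]) auto
    finally have pow: "(N / (y * u ^ x j)) ^ l = \<dots>" .
    have "N / (y * u ^ x j) \<in> E"
      by (intro subfield_divide[OF E] subfield_mult[OF E] subfield_power[OF E] N y u)
    from power_independentD[OF A this pow I(2)] have "l dvd x j" by simp
    then obtain k where k: "x j = l * k" by blast
    define c' where "c' = c / \<alpha> ^ k"
    have c'y: "c' ^ l = y" using cy \<alpha>nz
      by (simp add: c'_def k power_divide mult.commute flip: power_mult)
    have "c' \<in> adjoin E {\<alpha>}" unfolding c'_def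
      using c \<alpha>E' by (intro subfield_divide[OF E'] subfield_power[OF E'])
    then obtain s e where e: "e \<in> E" "c' = e * \<alpha> ^ s"
      using kummer_monomial[OF E z q, of c'] y c'y l0 by (metis power_0_left less_numeral_extra(3))
    \<comment> \<open>From \<open>c' = e * \<alpha> ^ s\<close> follows
      \<open>y = e ^ l * A j ^ s\<close>. The exponent \<open>(l - 1) * s\<close> is a natural
      number congruent to \<open>- s\<close> modulo \<open>l\<close>, so it completes
      \<open>y\<close> to an \<open>l\<close>-th power.\<close>
    define x' where "x' = x(j := (l - 1) * s)"
    have "(e * A j ^ s) ^ l = c' ^ l * A j ^ ((l - 1) * s)"
    proof -
      have "l * s = s + (l - 1) * s" using l0 by (cases l) auto
      moreover have "(\<alpha> ^ s) ^ l = A j ^ s" by (simp add: mult.commute flip: \<alpha> power_mult)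
      ultimately show ?thesis
        by (simp add: e(2) power_mult_distrib mult.commute[of s] flip: power_mult) (simp add: power_add)
    qed
    also have "\<dots> = (\<Prod>i\<in>I. A i ^ x' i)"
      using I c'y unfolding y_def x'_def by (subst prod.remove[of _ j]) (auto intro!: prod.cong)
    finally have "\<forall>i\<in>I. l dvd x' i"
      using power_independentD[OF A] e AE I by (blast intro: subfield_mult[OF E] subfield_power[OF E])
    then show ?thesis using k unfolding x'_def by (metis dvd_triv_left fun_upd_other)
  qed
  then show "power_independent (adjoin E {\<alpha>}) l I (A(j := \<alpha>))"
    using AE \<alpha>nz \<alpha>E' adjoin_superset(1)[of E "{\<alpha>}"]
    unfolding power_independent_def by auto
qed

text \<open>Induction on the total number of \<open>l\<close>-th roots still to be taken. The second
  conclusion allows a further tower to be put on top.\<close>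

theorem radical_tower:
  fixes \<gamma> :: "'i \<Rightarrow> 'a::alg_closed_field"
  assumes l: "Factorial_Ring.prime l" and "subfield E ambient"
    and "z \<in> E" and z: "root_of_unity_of_order l z" and "odd l \<or> (\<exists>u\<in>E. u ^ 2 = - 1)"
    and I: "finite I" and "power_independent E l I A" and "\<And>i. i \<in> I \<Longrightarrow> \<gamma> i ^ (l ^ e i) = A i"
  shows "ring.dimension ambient (l ^ (\<Sum>i\<in>I. e i)) E (adjoin E (\<gamma> ` I)) \<and>
    power_independent (adjoin E (\<gamma> ` I)) l I \<gamma>"
  using assms(2,3,5,7,8)
proof (induction "\<Sum>i\<in>I. e i" arbitrary: E A e)
  case 0
  then have \<gamma>: "\<gamma> i = A i" if "i \<in> I" for i using that I by (metis sum_eq_0_iff power_0 power_one_right)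
  then have "\<gamma> ` I \<subseteq> E" using 0 by (auto simp: power_independent_def)
  then have "adjoin E (\<gamma> ` I) = E" by (rule adjoin_absorb[OF \<open>subfield E ambient\<close>])
  moreover have "power_independent E l I \<gamma>"
    using 0 \<gamma> power_independent_cong[of I \<gamma> A] by blast
  ultimately show ?case
    using ambient.dimension_one[OF \<open>subfield E ambient\<close>] by (simp flip: 0(1))
next
  case (Suc n)
  then obtain j where j: "j \<in> I" "e j \<noteq> 0" by (metis sum.neutral nat.distinct(1))
  \<comment> \<open>The power of \<open>\<gamma> j\<close> just above \<open>A j\<close>: it is an
    \<open>l\<close>-th root of \<open>A j\<close> and needs one root extraction fewer to reach
    \<open>\<gamma> j\<close>.\<close>
  define \<alpha> where "\<alpha> = \<gamma> j ^ (l ^ (e j - 1))"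
  have "\<alpha> ^ l = \<gamma> j ^ (l ^ Suc (e j - 1))" by (simp add: \<alpha>_def mult.commute flip: power_mult)
  then have \<alpha>: "\<alpha> ^ l = A j" using j Suc by simp
  note step = power_independent_adjoin_root[OF l Suc.prems(1,2) z Suc.prems(3) I j(1) Suc.prems(4) \<alpha>]
  let ?E = "adjoin E {\<alpha>}"
  note E' = subfield_adjoin[of E "{\<alpha>}"]
  have sum: "n = (\<Sum>i\<in>I. (e(j := e j - 1)) i)"
  proof -
    have "(\<Sum>i\<in>I. e i) = e j + (\<Sum>i\<in>I - {j}. e i)" using I j by (simp add: sum.remove)
    moreover have "(\<Sum>i\<in>I. (e(j := e j - 1)) i) = (e j - 1) + (\<Sum>i\<in>I - {j}. e i)"
      using I j by (subst sum.remove[of _ j]) (auto intro!: sum.cong)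
    ultimately show ?thesis using Suc(2) j by linarith
  qed
  have "\<alpha> \<in> adjoin E (\<gamma> ` I)"
    unfolding \<alpha>_def using j adjoin_superset(2)[of "\<gamma> ` I" E]
    by (intro subfield_power[OF subfield_adjoin]) auto
  then have "adjoin E ({\<alpha>} \<union> \<gamma> ` I) = adjoin E (\<gamma> ` I)"
    using adjoin_superset(2)[of "\<gamma> ` I" E] adjoin_superset(2)[of "{\<alpha>} \<union> \<gamma> ` I" E]
    by (intro adjoin_cong) auto
  then have eq: "adjoin ?E (\<gamma> ` I) = adjoin E (\<gamma> ` I)" by (simp only: adjoin_adjoin)
  have "ring.dimension ambient (l ^ (\<Sum>i\<in>I. (e(j := e j - 1)) i)) ?E (adjoin ?E (\<gamma> ` I)) \<and>
    power_independent (adjoin ?E (\<gamma> ` I)) l I \<gamma>"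
  proof (rule Suc.hyps(1)[OF sum E' _ _ step(2)])
    show "z \<in> ?E" "odd l \<or> (\<exists>u\<in>?E. u ^ 2 = - 1)"
      using Suc.prems adjoin_superset(1)[of E "{\<alpha>}"] by blast+
    show "\<gamma> i ^ l ^ (e(j := e j - 1)) i = (A(j := \<alpha>)) i" if "i \<in> I" for i
      using that Suc.prems(5)[OF that] by (simp add: \<alpha>_def)
  qed
  moreover have "ring.dimension ambient l E ?E"
    using dimension_adjoin_singleton[OF Suc.prems(1) step(1)]
    unfolding radical_polynomial(1)[OF prime_gt_0_nat[OF l]] .
  ultimately show ?case
    using ambient.telescopic_base[OF Suc.prems(1) E'] unfolding eq sum[symmetric] Suc(2)[symmetric]
    by fastforce
qed

section \<open>Descent to the base field\<close>

lemma root_of_unity_power: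
  assumes "root_of_unity_of_order (k * j) z"
  shows "root_of_unity_of_order k (z ^ j)"
  using assms root_of_unity_power_eq_1_iff[OF assms] unfolding root_of_unity_of_order_def
  by (auto simp: power_mult[symmetric] mult.commute dest: dvd_imp_le)

lemma root_of_unity_mem:
  assumes "subfield E ambient" "z \<in> E" "root_of_unity_of_order k z" "w ^ k = 1"
  shows "w \<in> E"
  using root_of_unity_exponent[OF assms(3,4)] subfield_power[OF assms(1,2)] by metis

lemma power_prime_power_eq_1: "w ^ (l ^ a) = 1 \<Longrightarrow> a \<le> b \<Longrightarrow> w ^ (l ^ b) = 1"
  for w :: "'a::comm_monoid_mult"
  by (metis le_add_diff_inverse power_add power_mult power_one)

text \<open>Since \<open>z \<noteq> 1\<close>, it is a root of \<open>1 + X + ... + X^(l-1)\<close>,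
  which is \<open>f\<close> below.\<close>

lemma minpoly_root_of_unity_degree:
  assumes K: "subfield K ambient" and z: "root_of_unity_of_order l z" and "1 < l"
  obtains p where "minpoly K z p" "degree p < l"
proof -
  define f where "f = (\<Sum>i<l. monom (1::'a) i)"
  have "z \<noteq> 1" using z assms(3) by (auto simp: root_of_unity_of_order_def dest: spec[of _ 1])
  have c: "coeff f k = of_bool (k < l)" for k
    by (auto simp: f_def coeff_sum)
  have "poly f z = (\<Sum>i<l. z ^ i)" by (simp add: f_def poly_sum poly_monom)
  also have "\<dots> = 0" using z \<open>z \<noteq> 1\<close> by (simp add: geometric_sum root_of_unity_of_order_def)
  finally have "poly f z = 0" .
  moreover have "f \<in> poly_over K" by (simp add: poly_over_def c subfield_0[OF K] subfield_1[OF K])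
  moreover have "f \<noteq> 0" using c[of 0] assms(3) by auto
  moreover have "degree f < l" using assms(3) by (intro degree_lessI) (auto simp: c)
  ultimately show ?thesis using minpoly_exists[OF K] that by (metis le_less_trans)
qed

text \<open>The cyclotomic extension \<open>K(z)\<close> has degree below \<open>l\<close>, so a norm down to \<open>K\<close> raises elements
  of \<open>K\<close> to a power prime to \<open>l\<close>.\<close>

lemma strongly_independent_cyclotomic:
  fixes K :: "'a::alg_closed_field set"
  assumes l: "Factorial_Ring.prime l" and K: "subfield K ambient"
    and z: "root_of_unity_of_order l z" and B: "strongly_independent K l r B"
    and c: "c \<in> adjoin K {z}" "c ^ l = (\<Prod>i=1..r. B i ^ x i) * w" "w ^ (l ^ s) = 1"
  shows "\<forall>i\<in>{1..r}. l dvd x i"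
proof (rule ccontr)
  assume *: "\<not> (\<forall>i\<in>{1..r}. l dvd x i)"
  have l1: "0 < l" "1 < l" using prime_gt_1_nat[OF l] by auto
  define b where "b = (\<Prod>i=1..r. B i ^ x i)"
  have BK: "B i \<in> K" "B i \<noteq> 0" if "i \<in> {1..r}" for i
    using B that by (auto simp: strongly_independent_def)
  have b: "b \<in> K" "b \<noteq> 0" unfolding b_def using BK
    by (auto intro!: subfield_prod[OF K] subfield_power[OF K])
  have "w \<noteq> 0" using c(3) l1 by (auto simp: power_0_left)
  then have cnz: "c \<noteq> 0" using c(2)[folded b_def] b l1 by (auto simp: power_0_left)
  \<comment> \<open>One factor \<open>l\<close> turns \<open>c\<close> into \<open>b * w\<close>,
    and the factor \<open>l ^ s\<close> removes \<open>w\<close>, so \<open>c ^ N\<close> lies in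
    \<open>K\<close>.\<close>
  define N where "N = l * l ^ s"
  have N: "0 < N" "c ^ N = b ^ (l ^ s)"
    using l1 c by (auto simp: N_def power_mult power_mult_distrib b_def)
  obtain p where p: "minpoly K z p" "degree p < l"
    using minpoly_root_of_unity_degree[OF K z l1(2)] .
  have cN: "c ^ N \<in> K" using b N by (simp add: subfield_power[OF K])
  have "monom 1 N - [:c ^ N:] \<noteq> 0" using radical_polynomial(1)[OF N(1), of "c ^ N"] N(1) by force
  moreover have "poly (monom 1 N - [:c ^ N:]) c = 0" by (simp add: poly_monom)
  ultimately obtain q where q: "minpoly K c q"
    using minpoly_exists[OF K radical_polynomial(3)[OF N(1) K cN]] by blast
  define D where "D = degree q"
  have D: "0 < D" "D < l"
    using minpoly_degree_pos[OF q] minpoly_degree_le[OF K p(1) q c(1)] p(2) by (auto simp: D_def)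
  obtain v where v: "v ^ N = 1" "v * c ^ D \<in> K"
    using minpoly_radical_norm[OF K q cnz cN N(1)] D_def by blast
  \<comment> \<open>All roots of unity collected: \<open>b ^ D * w'\<close> is an
    \<open>l\<close>-th power in \<open>K\<close>. Since \<open>0 < D < l\<close>, the exponents
    \<open>D * x i\<close> are still not all divisible by \<open>l\<close>, contradicting strong
    independence.\<close>
  define w' where "w' = v ^ l * w ^ D"
  have bw: "b ^ D * w' = (v * c ^ D) ^ l"
  proof -
    have "(c ^ D) ^ l = (c ^ l) ^ D" by (simp add: mult.commute flip: power_mult)
    then have "(c ^ D) ^ l = (b * w) ^ D" using c(2) by (simp only: b_def)
    then show ?thesis by (simp add: w'_def power_mult_distrib)
  qed
  then have "w' = (v * c ^ D) ^ l / b ^ D" using b by (simp add: field_simps)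
  then have "w' \<in> K" using subfield_divide[OF K subfield_power[OF K v(2)] subfield_power[OF K b(1)]] by simp
  moreover have "w' ^ (l ^ s) = 1"
  proof -
    have "(w ^ D) ^ (l ^ s) = (w ^ (l ^ s)) ^ D" by (simp add: mult.commute flip: power_mult)
    moreover have "(v ^ l) ^ (l ^ s) = v ^ N" by (simp add: N_def flip: power_mult)
    ultimately show ?thesis using c(3) v(1) by (simp add: w'_def power_mult_distrib)
  qed
  moreover have "v * c ^ D \<noteq> 0" using v(1) N(1) cnz by (auto simp: power_0_left)
  ultimately have "\<not> strongly_indivisible K l (b ^ D)"
    using bw v(2) unfolding strongly_indivisible_def by blast
  moreover have "b ^ D = (\<Prod>i=1..r. B i powi int (D * x i))"
    unfolding power_int_of_nat by (simp add: b_def prod_power_distrib mult.commute flip: power_mult)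
  moreover have "\<not> (\<forall>i\<in>{1..r}. int l dvd int (D * x i))"
    using * D l by (auto simp: prime_dvd_mult_iff dest: dvd_imp_le simp del: of_nat_mult)
  ultimately show False
    using B unfolding strongly_independent_def by metis
qed

text \<open>In a relation, the power of \<open>a\<close> is a root of unity of
  \<open>l\<close>-power order, so the exponents of the \<open>B i\<close> are divisible by
  \<open>l\<close>. Dividing them out leaves an \<open>l\<close>-th root of \<open>a ^ x 0\<close>;
  if \<open>l\<close> did not divide \<open>x 0\<close>, it would have the excluded order
  \<open>l ^ Suc t\<close>.\<close>

lemma power_independent_cyclotomic:
  fixes K :: "'a::alg_closed_field set"
  assumes l: "Factorial_Ring.prime l" and K: "subfield K ambient"
    and z: "root_of_unity_of_order l z" and B: "strongly_independent K l r B"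
    and t: "1 \<le> t" and a: "a \<in> adjoin K {z}" "root_of_unity_of_order (l ^ t) a"
    and max: "\<And>w. w \<in> adjoin K {z} \<Longrightarrow> \<not> root_of_unity_of_order (l ^ Suc t) w"
  shows "power_independent (adjoin K {z}) l {0..r} (\<lambda>i. if i = 0 then a else B i)"
  unfolding power_independent_def
proof (intro conjI allI impI)
  let ?E = "adjoin K {z}"
  note E = subfield_adjoin[of K "{z}"]
  have BE: "B i \<in> ?E" "B i \<noteq> 0" if "i \<in> {1..r}" for i
    using B that adjoin_superset(1)[of K "{z}"] by (auto simp: strongly_independent_def)
  have anz: "a \<noteq> 0" by (rule root_of_unity_nonzero[OF a(2)])
  show "\<forall>i\<in>{0..r}. (if i = 0 then a else B i) \<in> ?E - {0}" using BE a anz by auto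
  fix x :: "nat \<Rightarrow> nat"
  assume "\<exists>c\<in>?E. c ^ l = (\<Prod>i = 0..r. (if i = 0 then a else B i) ^ x i)"
  moreover have "(\<Prod>i = 0..r. (if i = 0 then a else B i) ^ x i) = (\<Prod>i=1..r. B i ^ x i) * a ^ x 0"
    by (subst prod.atLeast_Suc_atMost) (auto simp: mult.commute intro!: prod.cong)
  ultimately obtain c where c: "c \<in> ?E" "c ^ l = (\<Prod>i=1..r. B i ^ x i) * a ^ x 0" by auto
  have "(a ^ x 0) ^ (l ^ t) = 1"
    using a(2) by (simp add: mult.commute root_of_unity_power_eq_1_iff[OF a(2)] flip: power_mult)
  with strongly_independent_cyclotomic[OF l K z B c] have x: "\<forall>i\<in>{1..r}. l dvd x i" by blast
  define e where "e = c / (\<Prod>i=1..r. B i ^ (x i div l))"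
  have e: "e \<in> ?E" unfolding e_def using c BE
    by (intro subfield_divide[OF E] subfield_prod[OF E] subfield_power[OF E])
  have "(\<Prod>i=1..r. B i ^ (x i div l)) ^ l = (\<Prod>i=1..r. B i ^ x i)"
    using x by (auto simp: prod_power_distrib intro!: prod.cong simp flip: power_mult)
  moreover have "(\<Prod>i=1..r. B i ^ x i) \<noteq> 0" using BE by auto
  ultimately have el: "e ^ l = a ^ x 0" using c(2) by (simp add: e_def power_divide)
  have "l dvd x 0"
  proof (rule ccontr)
    assume nd: "\<not> l dvd x 0"
    obtain t' where t': "t = Suc t'" using t by (cases t) auto
    have "e ^ (l ^ Suc k) = a ^ (x 0 * l ^ k)" for k using el by (simp add: power_mult)
    moreover have "\<not> l ^ t dvd x 0 * l ^ t'" using nd prime_gt_0_nat[OF l] by (auto simp: t')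
    ultimately have "root_of_unity_of_order (l ^ Suc t) e"
      using root_of_unity_power_eq_1_iff[OF a(2)]
      by (intro root_of_unity_prime_power[OF l]) (simp_all add: t' del: power_Suc)
    with max[OF e] show False by blast
  qed
  with x show "\<forall>i\<in>{0..r}. l dvd x i" by (metis atLeastAtMost_iff not_less_eq_eq One_nat_def le_zero_eq)
qed

text \<open>A unitriangular change of basis: in a relation between the twisted elements, the powers
  of \<open>z\<close> gather in the exponent at index 0 and the others stay the same.\<close>

lemma power_independent_twist:
  fixes r :: nat
  assumes A: "power_independent E l {0..r} (\<lambda>i. if i = 0 then z else B i)" and E: "subfield E ambient"
  shows "power_independent E l {1..r} (\<lambda>i. B i * z ^ s i)"
  unfolding power_independent_def
proof (intro conjI allI impI)
  have mem: "(if i = 0 then z else B i) \<in> E - {0}" if "i \<in> {0..r}" for i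
    using A that unfolding power_independent_def by blast
  have z: "z \<in> E" "z \<noteq> 0" using mem[of 0] by auto
  have B: "B i \<in> E \<and> B i \<noteq> 0" if "i \<in> {1..r}" for i
    using mem[of i] that by (auto split: if_splits)
  show "\<forall>i\<in>{1..r}. B i * z ^ s i \<in> E - {0}"
    using z B by (auto intro!: subfield_mult[OF E] subfield_power[OF E])
  fix x :: "nat \<Rightarrow> nat"
  assume "\<exists>c\<in>E. c ^ l = (\<Prod>i=1..r. (B i * z ^ s i) ^ x i)"
  then obtain c where c: "c \<in> E" "c ^ l = (\<Prod>i=1..r. (B i * z ^ s i) ^ x i)" by blast
  define y where "y = (\<lambda>i. if i = 0 then \<Sum>i=1..r. s i * x i else x i)"
  have "(\<Prod>i=1..r. (B i * z ^ s i) ^ x i) = z ^ y 0 * (\<Prod>i=1..r. B i ^ x i)"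
  proof -
    have "(\<Prod>i=1..r. (z ^ s i) ^ x i) = z ^ y 0"
      by (simp add: y_def power_sum flip: power_mult)
    then show ?thesis by (simp add: power_mult_distrib prod.distrib)
  qed
  also have "\<dots> = (\<Prod>i=0..r. (if i = 0 then z else B i) ^ y i)"
    by (subst (2) prod.atLeast_Suc_atMost) (auto simp: y_def intro!: prod.cong)
  finally have "c ^ l = \<dots>" using c by simp
  from power_independentD[OF A c(1) this] have "l dvd y i" if "i \<in> {0..r}" for i using that .
  moreover have "y i = x i" if "i \<in> {1..r}" for i using that by (simp add: y_def)
  ultimately show "\<forall>i\<in>{1..r}. l dvd x i" by fastforce
qed

lemma mult_group_inv:
  assumes K: "subfield K ambient" and "x \<in> K - {0}"
  shows "inv\<^bsub>mult_group K\<^esub> x = inverse x"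
proof (rule group.inv_equality)
  show "group (mult_group K)"
    using field.field_mult_group[OF ambient.subfield_iff(2)[OF K]]
    by (simp add: Ring_Divisibility.mult_of_def Multiplicative_Group.mult_of_def)
  show "inverse x \<otimes>\<^bsub>mult_group K\<^esub> x = \<one>\<^bsub>mult_group K\<^esub>" "x \<in> carrier (mult_group K)"
    "inverse x \<in> carrier (mult_group K)"
    using assms subfield_inverse[OF K] by (auto simp: Ring_Divisibility.mult_of_def)
qed

text \<open>The \<open>N\<close>-th powers of elements of \<open>M\<close> are closed under products
  and inverses, so it is enough to find roots of the generators.\<close>

lemma generate_power_root:
  assumes K: "subfield K ambient" and M: "subfield M ambient" and S: "S \<subseteq> K - {0}"
    and root: "S \<subseteq> (\<lambda>x. x ^ N) ` M" and g: "g \<in> generate (mult_group K) S"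
  shows "g \<in> (\<lambda>x. x ^ N) ` M"
  using g
proof induction
  case one
  show ?case using subfield_1[OF M] by (intro image_eqI[of _ _ 1]) (auto simp: Ring_Divisibility.mult_of_def)
next
  case (inv h)
  then obtain x where "x \<in> M" "h = x ^ N" using root by blast
  moreover have "inv\<^bsub>mult_group K\<^esub> h = inverse h" using inv S by (intro mult_group_inv[OF K]) auto
  ultimately show ?case using subfield_inverse[OF M]
    by (intro image_eqI[of _ _ "inverse x"]) (auto simp: power_inverse)
next
  case (eng g h)
  then obtain x y where "x \<in> M" "g = x ^ N" "y \<in> M" "h = y ^ N" by blast
  then show ?case using subfield_mult[OF M]
    by (intro image_eqI[of _ _ "x * y"]) (auto simp: power_mult_distrib Ring_Divisibility.mult_of_def)
qed (use root in blast)

theorem theorem4p1: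
  fixes K G :: "'a::{alg_closed_field, field_char_0} set"
    and \<zeta> :: "nat \<Rightarrow> 'a"
    and l r t m n :: nat
    and d h :: "nat \<Rightarrow> nat"
  assumes "number_field K"
    and "\<And>k. 0 < k \<Longrightarrow> root_of_unity_of_order k (\<zeta> k)"
    and "Factorial_Ring.prime l"
    and "odd l \<or> \<zeta> 4 \<in> K"
    and "subgroup G (mult_group K)"
    and "torsion_free G"
    and "has_rank G r" and "0 < r"
    and "1 \<le> t" and "adjoin K {\<zeta> l} = adjoin K {\<zeta> (l ^ t)}"
    and "\<And>s. adjoin K {\<zeta> l} = adjoin K {\<zeta> (l ^ s)} \<Longrightarrow> s \<le> t"
    and "0 < m" and "0 < n" and "max n t \<le> m"
    and "expresses_divisibility K l G r d h"
  defines "F \<equiv> adjoin K {\<zeta> (l ^ m)}"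
  defines "L \<equiv> radical_extension F (l ^ n) G"
  shows "finite_extension F L \<and>
    (\<exists>k. field_degree F L = l ^ k) \<and>
    int (Factorial_Ring.multiplicity l (field_degree F L)) =
      int (Max (insert m ((\<lambda>i. h i + min n (d i)) ` {1..r}))) - int m
        + int r * int n - (\<Sum>i=1..r. int (min n (d i)))"
proof -

  \<comment> \<open>Roots of unity and the generators of \<open>G\<close>\<close>
  note l = \<open>Factorial_Ring.prime l\<close> and root = assms(2)
  have K: "subfield K ambient" using assms(1) by (simp add: number_field_def)
  have l0: "0 < l" "1 < l" using prime_gt_1_nat[OF l] by auto
  have mt: "n \<le> m" "t \<le> m" using assms(14) by auto
  have root_l: "root_of_unity_of_order (l ^ s) (\<zeta> (l ^ s))" for s using root l0 by simp
  have \<zeta>_mem: "w \<in> E" if "subfield E ambient" "\<zeta> (l ^ b) \<in> E" "w ^ (l ^ a) = 1" "a \<le> b" for E w a b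
    using root_of_unity_mem[OF that(1,2) root_l] power_prime_power_eq_1[OF that(3,4)] by blast
  have \<zeta>l_mem: "\<zeta> l \<in> E" if "subfield E ambient" "\<zeta> (l ^ b) \<in> E" "1 \<le> b" for E b
    using \<zeta>_mem[OF that(1,2) _ that(3)] root_l[of 1] by (simp add: root_of_unity_of_order_def)
  obtain B w where B: "strongly_independent K l r B"
    and w: "\<And>i. i \<in> {1..r} \<Longrightarrow> w i \<in> K" "\<And>i. i \<in> {1..r} \<Longrightarrow> root_of_unity_of_order (l ^ h i) (w i)"
    and G: "G = generate (mult_group K) ((\<lambda>i. B i ^ (l ^ d i) * w i) ` {1..r})"
    using assms(15) unfolding expresses_divisibility_def by blast
  have BK: "B i \<in> K" "B i \<noteq> 0" if "i \<in> {1..r}" for i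
    using B that by (auto simp: strongly_independent_def)

  \<comment> \<open>The exponent \<open>M\<close> and a root of unity of order
    \<open>l ^ M\<close>\<close>
  define nn where "nn = (\<lambda>i. min n (d i))"
  define M where "M = Max (insert m ((\<lambda>i. h i + nn i) ` {1..r}))"
  have M: "m \<le> M" "\<And>i. i \<in> {1..r} \<Longrightarrow> h i + nn i \<le> M"
    unfolding M_def by (auto intro!: Max_ge simp del: Max_insert)
  have M_cases: "M \<in> insert m ((\<lambda>i. h i + nn i) ` {1..r})"
    unfolding M_def by (rule Max_in) auto
  \<comment> \<open>The chosen \<open>\<zeta> k\<close> need not be compatible for different
    \<open>k\<close>; below, \<open>a\<close> and \<open>z'\<close> are therefore taken as powers of
    this single root.\<close>
  define z where "z = \<zeta> (l ^ M)"
  have z: "root_of_unity_of_order (l ^ M) z" unfolding z_def by (rule root_l)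
  have z_power: "root_of_unity_of_order (l ^ s) (z ^ (l ^ (M - s)))" if "s \<le> M" for s
    using that z by (intro root_of_unity_power) (simp flip: power_add)

  \<comment> \<open>Independence over \<open>K(\<zeta> l)\<close>\<close>
  define E0 where "E0 = adjoin K {\<zeta> l}"
  have E0: "subfield E0 ambient" "K \<subseteq> E0" "\<zeta> l \<in> E0"
    unfolding E0_def using adjoin_superset[of K "{\<zeta> l}"] adjoin_superset(2)[of "{\<zeta> l}" K]
    by (auto intro: subfield_adjoin)
  have E0_t: "\<zeta> (l ^ t) \<in> E0"
    using adjoin_superset(2)[of "{\<zeta> (l ^ t)}" K] assms(10) by (simp add: E0_def)
  have sq: "odd l \<or> (\<exists>u\<in>K. u ^ 2 = - 1)"
  proof (cases "odd l")
    case False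
    then have "\<zeta> 4 \<in> K" using assms(4) by simp
    have "root_of_unity_of_order 4 (\<zeta> 4)" using root by simp
    then have "((\<zeta> 4)\<^sup>2)\<^sup>2 = 1" "(\<zeta> 4)\<^sup>2 \<noteq> 1"
      by (auto simp: root_of_unity_of_order_def dest: spec[of _ 2] simp flip: power_mult)
    then have "(\<zeta> 4)\<^sup>2 = - 1" using power2_eq_1_iff by blast
    with \<open>\<zeta> 4 \<in> K\<close> show ?thesis by blast
  qed simp

  define a where "a = z ^ (l ^ (M - t))"
  have a: "root_of_unity_of_order (l ^ t) a" unfolding a_def using mt M by (intro z_power) simp
  have "a \<in> E0" using a by (intro \<zeta>_mem[OF E0(1) E0_t]) (auto simp: root_of_unity_of_order_def)
  \<comment> \<open>Such an \<open>x\<close> would place \<open>\<zeta> (l ^ Suc t)\<close> in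
    \<open>E0\<close>, so that it generates the same field as \<open>\<zeta> l\<close>, against the
    maximality of \<open>t\<close>.\<close>
  have max: "\<not> root_of_unity_of_order (l ^ Suc t) x" if "x \<in> E0" for x
  proof
    assume x: "root_of_unity_of_order (l ^ Suc t) x"
    let ?y = "\<zeta> (l ^ Suc t)"
    have "?y \<in> E0"
      using root_l[of "Suc t"] by (intro root_of_unity_mem[OF E0(1) that x]) (simp add: root_of_unity_of_order_def)
    moreover have "\<zeta> l \<in> adjoin K {?y}"
      using adjoin_superset(2)[of "{?y}" K] by (intro \<zeta>l_mem[OF subfield_adjoin, of "Suc t"]) simp_all
    ultimately have "adjoin K {\<zeta> l} = adjoin K {?y}"
      by (intro adjoin_cong) (auto simp: E0_def)
    with assms(11) have "Suc t \<le> t" by blast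
    then show False by simp
  qed
  have ind0: "power_independent E0 l {0..r} (\<lambda>i. if i = 0 then a else B i)"
    using power_independent_cyclotomic[OF l K root[OF l0(1)] B assms(9) _ a] \<open>a \<in> E0\<close> max
    unfolding E0_def by blast

  \<comment> \<open>From \<open>E0\<close> up to \<open>F\<close>\<close>
  define z' where "z' = z ^ (l ^ (M - m))"
  have z': "root_of_unity_of_order (l ^ m) z'" unfolding z'_def using M by (intro z_power) simp
  have F: "subfield F ambient" "K \<subseteq> F" "\<zeta> (l ^ m) \<in> F"
    unfolding F_def using adjoin_superset[of K "{\<zeta> (l ^ m)}"] adjoin_superset(2)[of "{\<zeta> (l ^ m)}" K]
    by (auto intro: subfield_adjoin)
  have "z' \<in> F" using z' by (intro \<zeta>_mem[OF F(1,3)]) (auto simp: root_of_unity_of_order_def)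
  have "\<zeta> l \<in> F" using \<zeta>l_mem[OF F(1,3)] assms(12) by simp
  then have E0_F: "E0 \<subseteq> F" unfolding E0_def using F by (intro adjoin_least) auto

  \<comment> \<open>A tower with \<open>m - t\<close> roots over \<open>a\<close> and none over the
    \<open>B i\<close>; it serves to carry independence from \<open>E0\<close> to
    \<open>F\<close>.\<close>
  define \<gamma>1 where "\<gamma>1 = (\<lambda>i. if i = 0 then z' else B i)"
  have "power_independent (adjoin E0 (\<gamma>1 ` {0..r})) l {0..r} \<gamma>1"
  proof (rule radical_tower[OF l E0(1) E0(3) root[OF l0(1)] _ _ ind0, THEN conjunct2])
    show "odd l \<or> (\<exists>u\<in>E0. u\<^sup>2 = - 1)" using sq E0(2) by blast
    have "z' ^ (l ^ (m - t)) = a"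
      using M mt by (simp add: z'_def a_def flip: power_mult power_add)
    then show "\<gamma>1 i ^ (l ^ (if i = 0 then m - t else 0)) = (if i = 0 then a else B i)" for i
      by (simp add: \<gamma>1_def)
  qed simp
  moreover have "adjoin E0 (\<gamma>1 ` {0..r}) = F"
  proof
    show "adjoin E0 (\<gamma>1 ` {0..r}) \<subseteq> F"
      using E0_F F \<open>z' \<in> F\<close> BK by (intro adjoin_least) (auto simp: \<gamma>1_def)
    have "z' \<in> adjoin E0 (\<gamma>1 ` {0..r})"
      using adjoin_superset(2)[of "\<gamma>1 ` {0..r}" E0] by (force simp: \<gamma>1_def)
    then have "\<zeta> (l ^ m) \<in> adjoin E0 (\<gamma>1 ` {0..r})"
      by (rule root_of_unity_mem[OF subfield_adjoin _ z']) (use root_l[of m] in \<open>simp add: root_of_unity_of_order_def\<close>)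
    then show "F \<subseteq> adjoin E0 (\<gamma>1 ` {0..r})"
      unfolding F_def using E0(2) adjoin_superset(1)[of E0 "\<gamma>1 ` {0..r}"]
      by (intro adjoin_least subfield_adjoin) auto
  qed
  ultimately have ind1: "power_independent F l {0..r} \<gamma>1" by simp

  \<comment> \<open>Adjoining the root of unity of order \<open>l ^ M\<close>\<close>
  define \<gamma>2 where "\<gamma>2 = (\<lambda>i. if i = 0 then z else B i)"
  define F' where "F' = adjoin F (\<gamma>2 ` {0..r})"
  have F': "subfield F' ambient" "F \<subseteq> F'" "z \<in> F'"
    unfolding F'_def using adjoin_superset[of F "\<gamma>2 ` {0..r}"] adjoin_superset(2)[of "\<gamma>2 ` {0..r}" F]
    by (auto intro: subfield_adjoin simp: \<gamma>2_def image_subset_iff split: if_splits)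
  have "ring.dimension ambient (l ^ (\<Sum>i=0..r. if i = 0 then M - m else 0)) F F' \<and>
    power_independent F' l {0..r} \<gamma>2"
    unfolding F'_def
  proof (rule radical_tower[OF l F(1) \<open>\<zeta> l \<in> F\<close> root[OF l0(1)] _ _ ind1])
    show "odd l \<or> (\<exists>u\<in>F. u\<^sup>2 = - 1)" using sq F(2) by blast
  qed (simp_all add: \<gamma>1_def \<gamma>2_def z'_def)
  then have dim2: "ring.dimension ambient (l ^ (M - m)) F F'"
    and ind2: "power_independent F' l {0..r} (\<lambda>i. if i = 0 then z else B i)"
    by (simp_all add: \<gamma>2_def)

  \<comment> \<open>Roots of the generators of \<open>G\<close>\<close>
  define \<gamma> where "\<gamma> = (\<lambda>i. SOME x. x ^ (l ^ n) = B i ^ (l ^ d i) * w i)"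
  have \<gamma>: "\<gamma> i ^ (l ^ n) = B i ^ (l ^ d i) * w i" for i
    unfolding \<gamma>_def using l0 by (intro someI_ex[OF nth_root_exists]) simp
  \<comment> \<open>The root of unity hidden in \<open>\<gamma> i\<close>: it is an
    \<open>l ^ nn i\<close>-th root of \<open>w i\<close>, so its order divides
    \<open>l ^ (h i + nn i)\<close>. This is where the terms of the maximum come from.\<close>
  define \<xi> where "\<xi> = (\<lambda>i. \<gamma> i ^ (l ^ (n - nn i)) / B i ^ (l ^ (d i - nn i)))"
  have nn: "nn i \<le> n" "nn i \<le> d i" for i by (auto simp: nn_def)
  have \<xi>: "\<xi> i ^ (l ^ nn i) = w i" if "i \<in> {1..r}" for i
    using BK[OF that] nn[of i] by (simp add: \<xi>_def power_divide \<gamma> flip: power_mult power_add)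
  have \<xi>_eq_1: "\<xi> i ^ (l ^ (h i + nn i)) = 1" if "i \<in> {1..r}" for i
  proof -
    have "\<xi> i ^ (l ^ (h i + nn i)) = (\<xi> i ^ (l ^ nn i)) ^ (l ^ h i)"
      by (simp add: power_add mult.commute flip: power_mult)
    then show ?thesis using w(2)[OF that] \<xi>[OF that] by (simp add: root_of_unity_of_order_def)
  qed
  have \<xi>_power: "\<exists>s. \<xi> i = z ^ s" if "i \<in> {1..r}" for i
    by (rule root_of_unity_exponent[OF z power_prime_power_eq_1[OF \<xi>_eq_1[OF that] M(2)[OF that]]]) blast
  define s where "s = (\<lambda>i. SOME s. \<xi> i = z ^ s)"
  have s: "\<xi> i = z ^ s i" if "i \<in> {1..r}" for i
    unfolding s_def by (rule someI_ex[OF \<xi>_power[OF that]])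
  have \<gamma>_\<xi>: "\<gamma> i ^ (l ^ (n - nn i)) = \<xi> i * B i ^ (l ^ (d i - nn i))" if "i \<in> {1..r}" for i
    using BK[OF that] by (simp add: \<xi>_def)

  \<comment> \<open>Adjoining roots of the twisted \<open>B i\<close>\<close>
  define \<gamma>3 where "\<gamma>3 = (\<lambda>i. if d i < n then \<gamma> i else B i)"
  \<comment> \<open>If \<open>n \<le> d i\<close>, then \<open>\<gamma> i\<close> already lies in
    \<open>F'\<close>; the tower then takes \<open>B i\<close> itself with no twist, its exponent
    \<open>n - nn i\<close> being 0.\<close>
  define s' where "s' = (\<lambda>i. if d i < n then s i else 0)"
  define L' where "L' = adjoin F' (\<gamma>3 ` {1..r})"
  have L': "subfield L' ambient" "F' \<subseteq> L'" "\<gamma>3 ` {1..r} \<subseteq> L'"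
    unfolding L'_def by (intro subfield_adjoin adjoin_superset)+
  have "ring.dimension ambient (l ^ (\<Sum>i=1..r. n - nn i)) F' L' \<and> power_independent L' l {1..r} \<gamma>3"
    unfolding L'_def
  proof (rule radical_tower[OF l F'(1) _ root[OF l0(1)] _ _ power_independent_twist[OF ind2 F'(1), of s']])
    show "\<zeta> l \<in> F'" using \<open>\<zeta> l \<in> F\<close> F'(2) by blast
    show "odd l \<or> (\<exists>u\<in>F'. u\<^sup>2 = - 1)" using sq F(2) F'(2) by blast
    show "\<gamma>3 i ^ l ^ (n - nn i) = B i * z ^ s' i" if "i \<in> {1..r}" for i
      using \<gamma>_\<xi>[OF that] s[OF that] by (auto simp: \<gamma>3_def s'_def nn_def min_def)
  qed simp
  then have dim3: "ring.dimension ambient (l ^ (\<Sum>i=1..r. n - nn i)) F' L'" by blast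

  \<comment> \<open>Identification of the tower with the radical extension\<close>
  have "L' = L"
  proof
    show "L' \<subseteq> L" unfolding L_def radical_extension_def
    proof (rule Inter_greatest)
      fix T assume "T \<in> {T. subfield T ambient \<and> F \<subseteq> T \<and> (\<forall>g\<in>G. \<exists>x\<in>T. x ^ l ^ n = g)}"
      then have T: "subfield T ambient" "F \<subseteq> T" and Troot: "\<And>g. g \<in> G \<Longrightarrow> \<exists>x\<in>T. x ^ l ^ n = g" by auto
      have BT: "B i \<in> T" if "i \<in> {1..r}" for i using BK[OF that] F(2) T(2) by blast
      have \<zeta>T: "\<zeta> (l ^ m) \<in> T" using F(3) T(2) by blast
      have \<gamma>T: "\<gamma> i \<in> T" if i: "i \<in> {1..r}" for i
      proof -
        have "B i ^ (l ^ d i) * w i \<in> G" unfolding G using i by (intro generate.incl) auto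
        \<comment> \<open>\<open>T\<close> is only known to contain some root \<open>x\<close> of
          the generator; it differs from \<open>\<gamma> i\<close> by an \<open>l ^ n\<close>-th
          root of unity, which lies in \<open>T\<close> because \<open>n \<le> m\<close>.\<close>
        then obtain x where x: "x \<in> T" "x ^ l ^ n = \<gamma> i ^ (l ^ n)" using Troot \<gamma> by metis
        have "\<gamma> i ^ (l ^ n) \<noteq> 0" unfolding \<gamma> using BK[OF i] root_of_unity_nonzero[OF w(2)[OF i]] by simp
        then have "x \<noteq> 0" "(\<gamma> i / x) ^ l ^ n = 1" using x(2) l0 by (auto simp: power_divide power_0_left)
        then have "\<gamma> i / x \<in> T" using \<zeta>_mem[OF T(1) \<zeta>T] mt by blast
        then show ?thesis using subfield_mult[OF T(1) _ x(1)] \<open>x \<noteq> 0\<close> by fastforce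
      qed
      have \<xi>T: "\<xi> i \<in> T" if "i \<in> {1..r}" for i
        unfolding \<xi>_def using \<gamma>T[OF that] BT[OF that] by (intro subfield_divide[OF T(1)] subfield_power[OF T(1)])
      have zM: "z ^ l ^ M = 1" using z by (simp add: root_of_unity_of_order_def)
      have "z \<in> T"
      proof (cases "M = m")
        case True
        then show ?thesis using \<zeta>_mem[OF T(1) \<zeta>T zM] by simp
      next
        case False
        then obtain i where i: "i \<in> {1..r}" "M = h i + nn i" using M_cases by blast
        \<comment> \<open>As \<open>nn i \<le> n \<le> m < M\<close>, the maximum is attained with
          \<open>h i > 0\<close>. Then \<open>\<xi> i\<close> has order exactly
          \<open>l ^ M\<close>, and \<open>z\<close> is a power of it.\<close>
        have "h i \<noteq> 0" using False i M(1) nn(1)[of i] mt(1) by linarith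
        then obtain h' where h': "h i = Suc h'" by (cases "h i") auto
        have "\<xi> i ^ (l ^ (h' + nn i)) = w i ^ (l ^ h')"
          unfolding \<xi>[OF i(1), symmetric] by (simp add: power_add mult.commute flip: power_mult)
        also have "\<dots> \<noteq> 1" using root_of_unity_power_eq_1_iff[OF w(2)[OF i(1)], of "l ^ h'"] l0
          by (auto simp: h' dest: dvd_imp_le)
        finally have "root_of_unity_of_order (l ^ Suc (h' + nn i)) (\<xi> i)"
          using \<xi>_eq_1[OF i(1)] by (intro root_of_unity_prime_power[OF l]) (simp_all add: h')
        then show ?thesis using root_of_unity_mem[OF T(1) \<xi>T[OF i(1)], of "l ^ M" z] zM by (simp add: i(2) h')
      qed
      then have "F' \<subseteq> T" unfolding F'_def using T BT by (intro adjoin_least) (auto simp: \<gamma>2_def)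
      then show "L' \<subseteq> T" unfolding L'_def using T BT \<gamma>T by (intro adjoin_least) (auto simp: \<gamma>3_def)
    qed
    \<comment> \<open>Conversely, \<open>L'\<close> contains a root of each generator, hence of each
      element of \<open>G\<close>, and so is one of the fields in the intersection.\<close>
    have "\<gamma> i \<in> L'" if i: "i \<in> {1..r}" for i
    proof (cases "d i < n")
      case True
      then show ?thesis using L'(3) i by (auto simp: \<gamma>3_def image_subset_iff)
    next
      case False
      then have "\<gamma> i = z ^ s i * B i ^ (l ^ (d i - n))" using \<gamma>_\<xi>[OF i] s[OF i] by (simp add: nn_def min_def)
      moreover have "z \<in> L'" "B i \<in> L'" using F'(2,3) L'(2) F(2) BK[OF i] by blast+
      ultimately show ?thesis by (simp add: subfield_mult[OF L'(1)] subfield_power[OF L'(1)])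
    qed
    then have "(\<lambda>i. B i ^ (l ^ d i) * w i) ` {1..r} \<subseteq> (\<lambda>x. x ^ l ^ n) ` L'"
      using \<gamma> by (metis (no_types, lifting) image_eqI image_subsetI)
    moreover have "(\<lambda>i. B i ^ (l ^ d i) * w i) ` {1..r} \<subseteq> K - {0}"
      using BK w root_of_unity_nonzero[OF w(2)]
      by (auto intro!: subfield_mult[OF K] subfield_power[OF K])
    ultimately have "g \<in> (\<lambda>x. x ^ l ^ n) ` L'" if "g \<in> G" for g
      using generate_power_root[OF K L'(1)] that unfolding G by blast
    then have "\<forall>g\<in>G. \<exists>x\<in>L'. x ^ l ^ n = g" by blast
    then show "L \<subseteq> L'" unfolding L_def radical_extension_def using L' F'(2) by (intro Inter_lower) blast
  qed

  \<comment> \<open>The degree and its valuation\<close>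
  then have dim: "ring.dimension ambient (l ^ (M - m + (\<Sum>i=1..r. n - nn i))) F L"
    using ambient.telescopic_base[OF F(1) F'(1) dim2 dim3] by (simp add: power_add)
  then have "field_degree F L = l ^ (M - m + (\<Sum>i=1..r. n - nn i))"
    using ambient.dimI[OF F(1)] by (simp add: over_def)
  moreover have "multiplicity l (l ^ (M - m + (\<Sum>i=1..r. n - nn i))) = M - m + (\<Sum>i=1..r. n - nn i)"
    using l by (intro multiplicity_same_power) auto
  moreover have "int (M - m + (\<Sum>i=1..r. n - nn i)) = int M - int m + int r * int n - (\<Sum>i=1..r. int (nn i))"
    using M(1) nn(1) by (simp add: of_nat_diff sum_subtractf)
  ultimately show ?thesis
    using ambient.finite_dimensionI[OF dim] unfolding M_def nn_def by auto
qed

end
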